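(* For every probability measure $\rho$ on $\mathbb R$ which has compact support, is absolutely continuous with respect to the Lebesgue measure, and has density bounded by $1$, there exists a probability measure $Q(\rho)$ with compact support on $\mathbb R$ such that (as power series in $z$) $$\exp\left(-\sum_{k=0}^\infty s_kz^{k+1}\right)=1-\sum_{k=0}^\infty c_kz^{k+1},$$ where $s_k=\int_{\mathbb R}x^k\rho(dx)$ and $c_k=\int_{\mathbb R}x^kQ(\rho)(dx)$, $k=0,1,2,\dots$, are the moments of $\rho$ and $Q(\rho)$, respectively. The operation $Q$ intertwines the free convolution $\boxplus$ and the quantized free convolution $\otimes$: for any two such measures $\rho_1,\rho_2$, $$Q(\rho_1)\boxplus Q(\rho_2)=Q(\rho_1\otimes\rho_2).$$
   Context: For a compactly supported probability measure $\mathbf m$ on $\mathbb R$ with moments $M_k(\mathbf m)=\int x^k\,\mathbf m(dx)$ let $S_{\mathbf m}(z)=z+M_1(\mathbf m)z^2+M_2(\mathbf m)z^3+\dots$ and let $S_{\mathbf m}^{(-1)}(z)$ be the compositional inverse power series. Set $$R_{\mathbf m}(z)=\frac{1}{S_{\mathbf m}^{(-1)}(z)}-\frac1z,\qquad R^{quant}_{\mathbf m}(z)=\frac{1}{S_{\mathbf m}^{(-1)}(z)}-\frac{1}{1-e^{-z}}.$$ Free convolution: $\mathbf m^1\boxplus\mathbf m^2$ is the unique compactly supported probability measure with $R_{\mathbf m^1\boxplus\mathbf m^2}(z)=R_{\mathbf m^1}(z)+R_{\mathbf m^2}(z)$. Quantized free convolution: for compactly supported, absolutely continuous probability measures $\mathbf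 m^1,\mathbf m^2$ on $\mathbb R$ with densities bounded by $1$, $\mathbf m^1\otimes\mathbf m^2$ is the probability measure in the same class determined by $R^{quant}_{\mathbf m^1\otimes\mathbf m^2}(z)=R^{quant}_{\mathbf m^1}(z)+R^{quant}_{\mathbf m^2}(z)$. (It arises as the large-$N$ limit of the counting measures describing the decomposition into irreducibles of tensor products of irreducible representations of $U(N)$.) *)

theory Defs
  imports "HOL-Probability.Probability" "HOL-Computational_Algebra.Formal_Laurent_Series"
begin

definition compactly_supported :: "real measure \<Rightarrow> bool" where
  "compactly_supported m \<longleftrightarrow> (\<exists>K. compact K \<and> (AE x in m. x \<in> K))"

definition cs_prob :: "real measure \<Rightarrow> bool" where
  "cs_prob m \<longleftrightarrow> real_distribution m \<and> compactly_supported m"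

text \<open>A density is only determined up to a Lebesgue null set, hence so is the bound on it.\<close>
definition cs_prob_density_le_1 :: "real measure \<Rightarrow> bool" where
  "cs_prob_density_le_1 m \<longleftrightarrow> cs_prob m \<and> absolutely_continuous lborel m \<and>
     (AE x in lborel. RN_deriv lborel m x \<le> 1)"

definition moment :: "real measure \<Rightarrow> nat \<Rightarrow> real" where
  "moment m k = (\<integral>x. x ^ k \<partial>m)"

text \<open>The series \<open>M\<^sub>0 z + M\<^sub>1 z\<^sup>2 + M\<^sub>2 z\<^sup>3 + \<dots>\<close>; \<open>M\<^sub>0 = 1\<close> for a probability measure, so
  this is \<open>S\<^sub>m(z)\<close>, with zero constant term and invertible linear coefficient,
  as required for \<^const>\<open>fps_inv\<close> to be the compositional inverse.\<close>
definition moment_series :: "real measure \<Rightarrow> real fps" where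
  "moment_series m = fps_X * Abs_fps (moment m)"

text \<open>Both terms of the following differences have a simple pole at \<open>0\<close>, so the subtraction is
  carried out in the field of formal Laurent series.\<close>
definition R_transform :: "real measure \<Rightarrow> real fls" where
  "R_transform m = 1 / fps_to_fls (fps_inv (moment_series m)) - 1 / fls_X"

definition R_quant :: "real measure \<Rightarrow> real fls" where
  "R_quant m = 1 / fps_to_fls (fps_inv (moment_series m)) - 1 / fps_to_fls (1 - fps_exp (- 1))"

text \<open>Definite descriptions: meaningful for arguments in \<^const>\<open>cs_prob\<close>, respectively in
  \<^const>\<open>cs_prob_density_le_1\<close>, where exactly one such measure exists.\<close>
definition free_conv :: "real measure \<Rightarrow> real measure \<Rightarrow> real measure" (infixl \<open>\<boxplus>\<close> 65) where
  "m1 \<boxplus> m2 = (THE m. cs_prob m \<and> R_transform m = R_transform m1 + R_transform m2)"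

definition quant_free_conv :: "real measure \<Rightarrow> real measure \<Rightarrow> real measure" (infixl \<open>\<otimes>\<close> 70) where
  "m1 \<otimes> m2 = (THE m. cs_prob_density_le_1 m \<and> R_quant m = R_quant m1 + R_quant m2)"

end

theory Submission imports Defs begin

text \<open>
  If \<open>\<rho>\<close> is Lebesgue measure on a union of intervals \<open>[\<alpha>\<^sub>i, \<beta>\<^sub>i]\<close>, then
  \<open>exp(-S\<^sub>\<rho>(z)) = \<Prod> (1 - \<beta>\<^sub>i z) / (1 - \<alpha>\<^sub>i z)\<close>; by interlacing, the partial fraction expansion
  is \<open>1 - S\<^sub>\<mu>(z)\<close> for an atomic measure \<open>\<mu>\<close> with positive weights at the \<open>\<alpha>\<^sub>i\<close>, and every atomic
  measure arises in this way. Approximation and Helly's theorem extend both directions, so \<open>Q\<close> is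
  defined on all measures with density at most \<open>1\<close> and is onto the compactly supported probability
  measures. Since \<open>S\<^sub>Q = (1 - e\<^sup>-\<^sup>z) oo S\<^sub>\<rho>\<close>, the quantized R-transform of \<open>\<rho>\<close> is the R-transform
  of \<open>Q(\<rho>)\<close> composed with \<open>1 - e\<^sup>-\<^sup>z\<close>, so additivity is preserved. Thus existence of \<open>\<rho>\<^sub>1 \<otimes> \<rho>\<^sub>2\<close>
  reduces to existence of the free convolution: represent both measures by Jacobi matrices, form
  their free product, a symmetric operator on the binary tree, and take its spectral measure at the
  root. The resolvent at the root has a product form along the branches, which gives the
  subordination equations and hence additivity of the R-transform.
\<close>

text \<open>\<open>\<otimes>\<close> and \<open>\<boxplus>\<close> are definite descriptions, so the
  intertwining identity can be used only once both measures are known to exist; for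
  \<open>\<otimes>\<close> this includes a density bound that the transforms do not show. Hence the
  need for \<open>Q\<close> to be onto: the sum of the transforms is realized on the side of
  \<open>Q\<close>, where no density is prescribed, and pulled back. Uniqueness holds on both sides
  because moments determine a measure of compact support.

  Function theory of Cauchy transforms is avoided. All identities are between formal power series in
  the moments, and measures are obtained as weak limits of explicit ones with a common bound on the
  support. Each coefficient of a composition depends on finitely many moments, so identities pass to
  the limit. The density bound passes to the limit separately, as an inequality between measures of
  sets. In the same way the tree operator needs no spectral theorem: its moment of order
  \<open>k\<close> sees only words of length at most \<open>k\<close>, so finite matrices suffice,
  and for these positivity and the Hausdorff moment problem yield the measure.\<close>

section \<open>Compactly supported measures and their moments\<close>

text \<open>The radius is explicit so that a whole sequence of measures can share it: tightness and
  convergence of moments need a uniform bound.\<close>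

definition supported_within :: "real \<Rightarrow> real measure \<Rightarrow> bool" where
  "supported_within R m \<longleftrightarrow> real_distribution m \<and> (AE x in m. \<bar>x\<bar> \<le> R)"

lemma supported_within_imp_cs_prob: "supported_within R m \<Longrightarrow> cs_prob m"
  unfolding supported_within_def cs_prob_def compactly_supported_def
  by (auto intro!: exI[of _ "{-R..R}"] elim!: eventually_mono)

lemma cs_prob_supported_within:
  assumes "cs_prob m"
  obtains R where "supported_within R m" "R > 0"
proof -
  from assms obtain K where K: "compact K" "AE x in m. x \<in> K" "real_distribution m"
    unfolding cs_prob_def compactly_supported_def by auto
  then obtain B where B: "B > 0" "\<And>x. x \<in> K \<Longrightarrow> norm x \<le> B"
    using compact_imp_bounded[OF K(1)] by (auto simp: bounded_pos)
  then have "supported_within B m"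
    using K unfolding supported_within_def by (auto elim!: eventually_mono)
  with B that show ?thesis by blast
qed

lemma supported_within_mono: "supported_within R m \<Longrightarrow> R \<le> R' \<Longrightarrow> supported_within R' m"
  unfolding supported_within_def by (auto elim!: eventually_mono)

lemma supported_within_integrable:
  fixes f :: "real \<Rightarrow> real"
  assumes "supported_within R m" "continuous_on UNIV f"
  shows "integrable m f"
proof -
  interpret real_distribution m using assms(1) by (simp add: supported_within_def)
  have "compact (f ` {-R..R})"
    by (intro compact_continuous_image continuous_on_subset[OF assms(2)]) auto
  then obtain B where B: "\<And>x. x \<in> {-R..R} \<Longrightarrow> norm (f x) \<le> B"
    using compact_imp_bounded by (fastforce simp: bounded_iff)
  have meas: "f \<in> borel_measurable m"
    using borel_measurable_continuous_onI[OF assms(2)] by simp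
  have "AE x in m. \<bar>x\<bar> \<le> R" using assms(1) by (simp add: supported_within_def)
  then have "AE x in m. norm (f x) \<le> B"
    by eventually_elim (rule B, simp add: abs_le_iff)
  with meas show ?thesis by (intro integrable_const_bound[where B=B])
qed

text \<open>The Taylor polynomials of the characteristic function involve only moments, and the
  bounded support makes the remainder at most
  \<open>2 * (\<bar>t\<bar> * \<bar>R\<bar>) ^ n / fact n\<close>. So moments determine the
  characteristic function, and Levy's uniqueness theorem applies.\<close>

lemma supported_within_moment_eqI:
  assumes m1: "supported_within R m1" and m2: "supported_within R m2"
    and eq: "\<And>k. moment m1 k = moment m2 k"
  shows "m1 = m2"
proof -
  interpret M1: real_distribution m1 using m1 by (simp add: supported_within_def)
  interpret M2: real_distribution m2 using m2 by (simp add: supported_within_def)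
  have bound: "(\<lambda>n. cmod (char m t - (\<Sum>k\<le>n. ((\<i> * t)^k / fact k) * (\<integral>x. x^k \<partial>m)))) \<longlonglongrightarrow> 0"
    if m: "supported_within R m" for m and t :: real
  proof -
    interpret M: real_distribution m using m by (simp add: supported_within_def)
    have le: "cmod (char m t - (\<Sum>k\<le>n. ((\<i> * t)^k / fact k) * (\<integral>x. x^k \<partial>m))) \<le>
        2 * (\<bar>t\<bar> * \<bar>R\<bar>)^n / fact n" for n
    proof -
      have "(\<integral>x. \<bar>x\<bar>^n \<partial>m) \<le> (\<integral>x. \<bar>R\<bar>^n \<partial>m)"
        by (intro integral_mono_AE supported_within_integrable[OF m] continuous_intros)
           (use m in \<open>auto simp: supported_within_def elim!: eventually_mono intro!: power_mono\<close>)
      then have "(2*\<bar>t\<bar>^n / fact n) * (\<integral>x. \<bar>x\<bar>^n \<partial>m) \<le> (2*\<bar>t\<bar>^n / fact n) * \<bar>R\<bar>^n"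
        by (intro mult_left_mono) (simp_all add: M.prob_space[simplified])
      moreover have "cmod (char m t - (\<Sum>k\<le>n. ((\<i> * t)^k / fact k) * (\<integral>x. x^k \<partial>m)))
          \<le> (2*\<bar>t\<bar>^n / fact n) * (\<integral>x. \<bar>x\<bar>^n \<partial>m)"
        by (intro M.char_approx1 supported_within_integrable[OF m] continuous_intros)
      ultimately show ?thesis by (simp add: power_mult_distrib)
    qed
    have "(\<lambda>n. 2 * ((\<bar>t\<bar> * \<bar>R\<bar>)^n / fact n)) \<longlonglongrightarrow> 2 * 0"
      by (intro tendsto_mult tendsto_const) (use summable_LIMSEQ_zero[OF summable_exp, of "\<bar>t\<bar> * \<bar>R\<bar>"] in \<open>simp add: divide_inverse mult.commute\<close>)
    then have "(\<lambda>n. 2 * ((\<bar>t\<bar> * \<bar>R\<bar>)^n / fact n)) \<longlonglongrightarrow> 0" by simp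
    then show ?thesis
      by (rule Lim_null_comparison[rotated]) (use le in auto)
  qed
  have "char m1 t = char m2 t" for t
  proof -
    have "(\<lambda>n. \<Sum>k\<le>n. ((\<i> * t)^k / fact k) * (\<integral>x. x^k \<partial>m1)) \<longlonglongrightarrow> char m1 t"
      using bound[OF m1, of t] by (simp add: tendsto_iff dist_norm norm_minus_commute)
    moreover have "(\<lambda>n. \<Sum>k\<le>n. ((\<i> * t)^k / fact k) * (\<integral>x. x^k \<partial>m1)) \<longlonglongrightarrow> char m2 t"
      using bound[OF m2, of t] eq unfolding moment_def
      by (simp add: tendsto_iff dist_norm norm_minus_commute)
    ultimately show ?thesis by (rule LIMSEQ_unique)
  qed
  then show ?thesis
    by (intro Levy_uniqueness M1.real_distribution_axioms M2.real_distribution_axioms) auto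
qed

lemma cs_prob_moment_eqI:
  assumes "cs_prob m1" "cs_prob m2" "\<And>k. moment m1 k = moment m2 k"
  shows "m1 = m2"
proof -
  obtain R1 where "supported_within R1 m1" by (rule cs_prob_supported_within[OF assms(1)])
  moreover obtain R2 where "supported_within R2 m2" by (rule cs_prob_supported_within[OF assms(2)])
  ultimately have "supported_within (max R1 R2) m1" "supported_within (max R1 R2) m2"
    by (auto intro: supported_within_mono)
  then show ?thesis by (rule supported_within_moment_eqI) (rule assms(3))
qed

lemma supported_within_moment_0: "supported_within R m \<Longrightarrow> moment m 0 = 1"
  unfolding moment_def supported_within_def real_distribution_def
  using prob_space.prob_space by fastforce

lemma cs_prob_moment_0: "cs_prob m \<Longrightarrow> moment m 0 = 1"
  by (erule cs_prob_supported_within) (rule supported_within_moment_0)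

lemma tight_supported_within:
  assumes "\<And>n. supported_within R (M n)"
  shows "tight M"
  unfolding tight_def
proof (intro conjI allI impI)
  fix n show "real_distribution (M n)" using assms by (simp add: supported_within_def)
next
  fix e :: real assume e: "e > 0"
  show "\<exists>a b. a < b \<and> (\<forall>n. measure (M n) {a<..b} > 1 - e)"
  proof (intro exI conjI allI)
    \<comment> \<open>The interval is open on the left and has to contain \<open>- R\<close>, hence
      the extra 1.\<close>
    show "- \<bar>R\<bar> - 1 < \<bar>R\<bar>" by simp
    fix n
    interpret real_distribution "M n" using assms by (simp add: supported_within_def)
    have "measure (M n) {- \<bar>R\<bar> - 1<..\<bar>R\<bar>} = 1"
      using assms[of n] by (intro prob_eq_1[THEN iffD2])
        (auto simp: supported_within_def elim!: eventually_mono)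
    with e show "measure (M n) {- \<bar>R\<bar> - 1<..\<bar>R\<bar>} > 1 - e" by simp
  qed
qed

text \<open>Weak convergence tests only bounded continuous functions. So the support is detected by
  a bounded function \<open>d\<close> that vanishes exactly on \<open>[-R, R]\<close>, and powers
  are replaced by powers of the argument clamped to \<open>[-R, R]\<close>, which have the same
  integrals.\<close>

lemma supported_within_weak_limit:
  assumes M: "\<And>n. supported_within R (M n)" and "real_distribution m" "weak_conv_m M m" and R: "R \<ge> 0"
  shows "supported_within R m" and "(\<lambda>n. moment (M n) k) \<longlonglongrightarrow> moment m k"
proof -
  have rd: "real_distribution (M n)" for n using M by (simp add: supported_within_def)
  interpret m: real_distribution m by fact
  define d :: "real \<Rightarrow> real" where "d x = min 1 (max 0 (\<bar>x\<bar> - R))" for x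
  have [measurable]: "d \<in> borel_measurable borel" unfolding d_def by measurable
  have "(\<lambda>n. integral\<^sup>L (M n) d) \<longlonglongrightarrow> integral\<^sup>L m d"
    by (rule weak_conv_imp_integral_bdd_continuous_conv[OF rd assms(2,3), where B=1])
       (auto simp: d_def[abs_def] intro!: continuous_intros)
  moreover have "integral\<^sup>L (M n) d = 0" for n
  proof -
    interpret real_distribution "M n" by (rule rd)
    have "integral\<^sup>L (M n) d = (\<integral>x. 0 \<partial>M n)"
      by (rule integral_cong_AE) (use M[of n] in \<open>auto simp: supported_within_def d_def elim!: eventually_mono\<close>)
    then show ?thesis by simp
  qed
  ultimately have int0: "integral\<^sup>L m d = 0" by (simp add: LIMSEQ_const_iff)
  have "AE x in m. d x = 0"
    using int0 by (subst (asm) integral_nonneg_eq_0_iff_AE)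
      (auto intro!: m.integrable_const_bound[where B=1] simp: d_def)
  then have "AE x in m. \<bar>x\<bar> \<le> R"
    by eventually_elim (auto simp: d_def min_def max_def split: if_splits)
  with assms(2) show supp: "supported_within R m" by (simp add: supported_within_def)
  define f :: "real \<Rightarrow> real" where "f x = (max (-R) (min R x)) ^ k" for x
  have [measurable]: "f \<in> borel_measurable borel" unfolding f_def by measurable
  have "(\<lambda>n. integral\<^sup>L (M n) f) \<longlonglongrightarrow> integral\<^sup>L m f"
  proof (rule weak_conv_imp_integral_bdd_continuous_conv[OF rd assms(2,3), where B="R^k"])
    show "isCont f x" for x unfolding f_def by (intro continuous_intros)
    show "norm (f x) \<le> R ^ k" for x
      unfolding f_def norm_power using R by (intro power_mono) auto
  qed
  moreover have "integral\<^sup>L m' f = moment m' k" if "supported_within R m'" for m'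
  proof -
    interpret real_distribution m' using that by (simp add: supported_within_def)
    show ?thesis unfolding moment_def
      by (rule integral_cong_AE) (use that in \<open>auto simp: f_def supported_within_def elim!: eventually_mono\<close>)
  qed
  ultimately show "(\<lambda>n. moment (M n) k) \<longlonglongrightarrow> moment m k" using supp M by simp
qed

lemma helly_moments:
  fixes M :: "nat \<Rightarrow> real measure"
  assumes M: "\<And>n. supported_within R (M n)" and R: "R \<ge> 0"
  obtains r m where "strict_mono r" "supported_within R m" "weak_conv_m (M \<circ> r) m"
    "\<And>k. (\<lambda>n. moment (M (r n)) k) \<longlonglongrightarrow> moment m k"
proof -
  have "tight M" by (rule tight_supported_within) (rule M)
  from tight_imp_convergent_subsubsequence[OF this strict_mono_id]
  obtain r m where r: "strict_mono r" "real_distribution m" "weak_conv_m (M \<circ> id \<circ> r) m"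
    by (elim exE conjE)
  have s: "supported_within R ((M \<circ> r) n)" for n using M by simp
  have w: "weak_conv_m (M \<circ> r) m" using r by simp
  have "(\<lambda>n. moment (M (r n)) k) \<longlonglongrightarrow> moment m k" for k
    using supported_within_weak_limit(2)[OF s r(2) w R] by simp
  with r(1) supported_within_weak_limit(1)[OF s r(2) w R] w show ?thesis using that by blast
qed

text \<open>The measures themselves need not be known to converge: a weakly convergent subsequence
  has the same limits of moments.\<close>

lemma moment_limit:
  assumes M: "\<And>n. supported_within R (M n)" and R: "R \<ge> 0"
    and c: "\<And>k. (\<lambda>n. moment (M n) k) \<longlonglongrightarrow> c k"
  obtains m where "supported_within R m" "\<And>k. moment m k = c k"
proof -
  obtain r m where r: "strict_mono r" "supported_within R m"
    "\<And>k. (\<lambda>n. moment (M (r n)) k) \<longlonglongrightarrow> moment m k"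
    using helly_moments[where M=M, OF M R] by blast
  have "moment m k = c k" for k
    using r(3)[of k] LIMSEQ_subseq_LIMSEQ[OF c[of k] r(1)] by (simp add: o_def LIMSEQ_unique)
  with r(2) show ?thesis using that by blast
qed

lemma atomic_measure:
  fixes w x :: "'i \<Rightarrow> real"
  assumes I: "finite I" and w: "\<And>i. i \<in> I \<Longrightarrow> w i \<ge> 0" "(\<Sum>i\<in>I. w i) = 1"
    and x: "\<And>i. i \<in> I \<Longrightarrow> \<bar>x i\<bar> \<le> R"
  obtains m where "supported_within R m" "\<And>k. moment m k = (\<Sum>i\<in>I. w i * x i ^ k)"
proof -
  define f where "f i = (if i \<in> I then w i else 0)" for i
  have f: "f i \<ge> 0" for i using w by (simp add: f_def)
  have "(\<integral>\<^sup>+ i. ennreal (f i) \<partial>count_space UNIV) = (\<Sum>i\<in>I. ennreal (f i))"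
    by (intro nn_integral_count_space'[OF I]) (auto simp: f_def)
  also have "\<dots> = ennreal (\<Sum>i\<in>I. f i)" using f by (simp add: sum_ennreal)
  also have "(\<Sum>i\<in>I. f i) = 1" using w by (simp add: f_def)
  finally have sum1: "(\<integral>\<^sup>+ i. ennreal (f i) \<partial>count_space UNIV) = 1" by simp
  define p where "p = embed_pmf f"
  have p: "pmf p i = f i" for i
    unfolding p_def by (rule pmf_embed_pmf[OF f sum1])
  have sub: "set_pmf p \<subseteq> I" by (auto simp: set_pmf_eq p f_def split: if_splits)
  define m where "m = distr (measure_pmf p) borel x"
  have "real_distribution m"
    unfolding m_def by (rule prob_space.real_distribution_distr[OF measure_pmf.prob_space_axioms]) simp
  moreover have "AE y in m. \<bar>y\<bar> \<le> R"
    unfolding m_def by (subst AE_distr_iff) (use sub x in \<open>auto simp: AE_measure_pmf_iff\<close>)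
  moreover have "moment m k = (\<Sum>i\<in>I. w i * x i ^ k)" for k
  proof -
    have "moment m k = (\<integral>i. x i ^ k \<partial>measure_pmf p)"
      unfolding moment_def m_def by (subst integral_distr) auto
    also have "\<dots> = (\<Sum>i\<in>I. x i ^ k * pmf p i)"
      by (rule integral_measure_pmf_real[OF I]) (use sub in auto)
    finally show ?thesis by (simp add: p f_def mult.commute)
  qed
  ultimately show ?thesis by (intro that[of m]) (simp_all add: supported_within_def)
qed

section \<open>Measures dominated by Lebesgue measure\<close>

text \<open>With the converse \<open>cs_prob_density_le_1I\<close> this trades the Radon-Nikodym
  derivative for an inequality between measures, which is the form that survives weak
  limits.\<close>

lemma cs_prob_density_le_1_emeasure_le:
  assumes "cs_prob_density_le_1 m" "A \<in> sets borel"
  shows "emeasure m A \<le> emeasure lborel A"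
proof -
  have m: "cs_prob m" "absolutely_continuous lborel m" "AE x in lborel. RN_deriv lborel m x \<le> 1"
    using assms(1) by (auto simp: cs_prob_density_le_1_def)
  have sets_m: "sets m = sets lborel"
    using m(1) by (simp add: cs_prob_def real_distribution.events_eq_borel)
  have "m = density lborel (RN_deriv lborel m)"
    using sigma_finite_measure.density_RN_deriv[OF sigma_finite_lborel m(2) sets_m] by simp
  then have "emeasure m A = emeasure (density lborel (RN_deriv lborel m)) A" by simp
  also have "\<dots> = (\<integral>\<^sup>+x. RN_deriv lborel m x * indicator A x \<partial>lborel)"
    using assms(2) by (intro emeasure_density) auto
  also have "\<dots> \<le> (\<integral>\<^sup>+x. indicator A x \<partial>lborel)"
    using m(3) by (intro nn_integral_mono_AE) (auto elim!: eventually_mono split: split_indicator)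
  finally show ?thesis using assms(2) by simp
qed

lemma cs_prob_density_le_1I:
  assumes m: "cs_prob m" and le: "\<And>A. A \<in> sets borel \<Longrightarrow> emeasure m A \<le> emeasure lborel A"
  shows "cs_prob_density_le_1 m"
proof -
  interpret real_distribution m using m by (simp add: cs_prob_def)
  have sets_m: "sets m = sets lborel" by simp
  have ac: "absolutely_continuous lborel m"
    unfolding absolutely_continuous_def
  proof
    fix A :: "real set" assume "A \<in> null_sets lborel"
    then show "A \<in> null_sets m" using le[of A] by (auto simp: null_sets_def)
  qed
  define f where "f = RN_deriv lborel m"
  have [measurable]: "f \<in> borel_measurable borel" unfolding f_def by measurable
  have dens: "m = density lborel f"
    using sigma_finite_measure.density_RN_deriv[OF sigma_finite_lborel ac sets_m] by (simp add: f_def)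
  have "AE x in lborel. f x \<le> 1"
  proof (rule ccontr)
    assume neg: "\<not> (AE x in lborel. f x \<le> 1)"
    \<comment> \<open>Cutting to bounded sets makes the Lebesgue measure finite, as the strict
      comparison of integrals requires.\<close>
    define A where "A n = {x \<in> {-real n..real n}. f x > 1}" for n :: nat
    have [measurable]: "A n \<in> sets borel" for n unfolding A_def by measurable
    have "AE x in lborel. f x \<le> 1" if "\<forall>n. AE x in lborel. x \<notin> A n"
    proof -
      have "AE x in lborel. \<forall>n. x \<notin> A n" using that by (simp add: AE_all_countable)
      then show ?thesis
      proof eventually_elim
        fix x assume "\<forall>n. x \<notin> A n"
        moreover obtain n where "\<bar>x\<bar> \<le> real n" using real_arch_simple by blast
        ultimately show "f x \<le> 1" unfolding A_def by (auto simp: abs_le_iff not_less)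
      qed
    qed
    with neg obtain n where n: "\<not> (AE x in lborel. x \<notin> A n)" by blast
    have fin: "emeasure lborel (A n) < \<infinity>"
      by (rule le_less_trans[OF emeasure_mono[of _ "{-real n..real n}"]]) (auto simp: A_def)
    have "(\<integral>\<^sup>+x. f x * indicator (A n) x \<partial>lborel) = emeasure m (A n)"
      by (subst dens) (simp add: emeasure_density)
    also have "\<dots> \<le> emeasure lborel (A n)" by (rule le) simp
    also have "\<dots> = (\<integral>\<^sup>+x. indicator (A n) x \<partial>lborel)" by simp
    finally have "(\<integral>\<^sup>+x. f x * indicator (A n) x \<partial>lborel) \<le> (\<integral>\<^sup>+x. indicator (A n) x \<partial>lborel)" .
    then have "\<not> (\<integral>\<^sup>+x. indicator (A n) x \<partial>lborel) < (\<integral>\<^sup>+x. f x * indicator (A n) x \<partial>lborel)"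
      by (simp add: not_less)
    moreover have "(\<integral>\<^sup>+x. indicator (A n) x \<partial>lborel) < (\<integral>\<^sup>+x. f x * indicator (A n) x \<partial>lborel)"
    proof (rule nn_integral_less)
      show "(\<integral>\<^sup>+x. indicator (A n) x \<partial>lborel) \<noteq> \<infinity>" using fin by simp
      show "AE x in lborel. indicator (A n) x \<le> f x * indicator (A n) x"
        by (auto simp: A_def split: split_indicator)
      show "\<not> (AE x in lborel. f x * indicator (A n) x \<le> (indicator (A n) x :: ennreal))"
        using n by (rule contrapos_nn) (auto elim!: eventually_mono simp: A_def split: split_indicator_asm)
    qed auto
    ultimately show False by simp
  qed
  with m ac show ?thesis by (simp add: cs_prob_density_le_1_def f_def)
qed

text \<open>The hypothesis says that \<open>x - cdf m x\<close> is nondecreasing, so it defines a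
  Stieltjes measure \<open>n\<close>. The sum of \<open>m\<close> and \<open>n\<close> agrees with
  Lebesgue measure on half-open intervals, hence everywhere, and dropping \<open>n\<close> gives the
  inequality.\<close>

lemma le_lborelI_cdf:
  assumes "real_distribution m" and cdf_le: "\<And>a b. a \<le> b \<Longrightarrow> cdf m b - cdf m a \<le> b - a"
    and A: "A \<in> sets borel"
  shows "emeasure m A \<le> emeasure lborel A"
proof -
  interpret real_distribution m by fact
  define G where "G x = x - cdf m x" for x
  have G_mono: "G x \<le> G y" if "x \<le> y" for x y using cdf_le[OF that] by (simp add: G_def)
  have G_cont: "continuous (at_right a) G" for a
    unfolding G_def by (intro continuous_intros cdf_is_right_cont)
  define n where "n = interval_measure G"
  define s where "s = measure_of UNIV (sets borel) (\<lambda>A. emeasure m A + emeasure n A)"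
  have sets_n: "sets n = sets borel" by (simp add: n_def)
  have sets_s: "sets s = sets borel"
    unfolding s_def using sets.sigma_sets_eq[of "borel :: real measure"] by (simp add: sets_measure_of)
  have em: "emeasure s B = emeasure m B + emeasure n B" if "B \<in> sets borel" for B
  proof (rule emeasure_measure_of[OF s_def])
    show "countably_additive (sets s) (\<lambda>A. emeasure m A + emeasure n A)"
      unfolding sets_s
    proof (rule countably_additiveI)
      fix B :: "nat \<Rightarrow> real set" assume B: "range B \<subseteq> sets borel" "disjoint_family B"
      show "(\<Sum>i. emeasure m (B i) + emeasure n (B i)) = emeasure m (\<Union>i. B i) + emeasure n (\<Union>i. B i)"
        using B by (simp add: suminf_add[symmetric] suminf_emeasure sets_n)
    qed
  qed (auto simp: positive_def that sets_s)
  have Ioc: "emeasure s {a<..b} = emeasure lborel {a<..b}" for a b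
  proof (cases "a \<le> b")
    case True
    have "emeasure s {a<..b} = ennreal (cdf m b - cdf m a) + ennreal (G b - G a)"
      unfolding n_def using True G_mono G_cont
      by (subst em) (simp_all add: n_def emeasure_Ioc emeasure_interval_measure_Ioc)
    also have "\<dots> = ennreal (b - a)"
      using True G_mono[OF True] cdf_nondecreasing[OF True]
      by (subst ennreal_plus[symmetric]) (auto simp: G_def)
    finally show ?thesis using True by simp
  qed simp
  have "s = lborel"
  proof (rule measure_eqI_generator_eq[where \<Omega>=UNIV and E="range (\<lambda>(a, b). {a<..b::real})"
      and A="\<lambda>i. {- real (i::nat)<..real i}"])
    show "(\<Union>i. {- real (i::nat)<..real i}) = UNIV" by (rule UN_Ioc_eq_UNIV)
  qed (auto simp: Ioc sets_s borel_sigma_sets_Ioc Int_stable_def)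
  then have "emeasure lborel A = emeasure m A + emeasure n A" using em[OF A] by simp
  then show ?thesis by simp
qed

lemma weak_limit_le_lborel:
  assumes M: "\<And>n. real_distribution (M n)" and m: "real_distribution m" and lim: "weak_conv_m M m"
    and le: "\<And>n A. A \<in> sets borel \<Longrightarrow> emeasure (M n) A \<le> emeasure lborel A"
    and A: "A \<in> sets borel"
  shows "emeasure m A \<le> emeasure lborel A"
proof (rule le_lborelI_cdf[OF m _ A])
  interpret m: real_distribution m by fact
  fix a b :: real assume ab: "a \<le> b"
  have ctble: "countable {x. \<not> isCont (cdf m) x}"
    by (intro mono_ctble_discont monoI m.cdf_nondecreasing)
  have cont_le: "cdf m y - cdf m x \<le> y - x" if "isCont (cdf m) x" "isCont (cdf m) y" "x \<le> y" for x y
  proof (rule tendsto_upperbound)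
    show "(\<lambda>n. cdf (M n) y - cdf (M n) x) \<longlonglongrightarrow> cdf m y - cdf m x"
      using lim that by (intro tendsto_diff) (auto simp: weak_conv_m_def weak_conv_def)
    have "cdf (M n) y - cdf (M n) x \<le> y - x" for n
    proof -
      interpret real_distribution "M n" by fact
      have "ennreal (cdf (M n) y - cdf (M n) x) \<le> ennreal (y - x)"
        using le[of "{x<..y}" n] that emeasure_Ioc[of x y] by simp
      moreover have "y - x \<ge> 0" using that by simp
      ultimately show ?thesis by (subst (asm) ennreal_le_iff)
    qed
    then show "\<forall>\<^sub>F n in sequentially. cdf (M n) y - cdf (M n) x \<le> y - x" by simp
  qed simp
  show "cdf m b - cdf m a \<le> b - a"
  proof (cases "a = b")
    case False
    with ab have ab: "a < b" by simp
    \<comment> \<open>Convergence of the distribution functions is known only at continuity points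
      of the limit. These are dense, so \<open>a\<close> and \<open>b\<close> are replaced by such
      points slightly to their right; right continuity controls the change at \<open>a\<close>,
      monotonicity the one at \<open>b\<close>.\<close>
    show ?thesis
    proof (rule field_le_epsilon)
      fix e :: real assume e: "e > 0"
      have "(cdf m \<longlongrightarrow> cdf m a) (at_right a)"
        using m.cdf_is_right_cont[of a] by (simp add: continuous_within)
      then have "\<forall>\<^sub>F x in at_right a. cdf m x < cdf m a + e/2"
        using e by (auto simp: order_tendsto_iff)
      then obtain d where d: "d > a" "\<And>x. a < x \<Longrightarrow> x < d \<Longrightarrow> cdf m x < cdf m a + e/2"
        by (auto simp: eventually_at_right_field)
      obtain x where x: "x \<in> {a<..<min d b}" "isCont (cdf m) x"
        using open_minus_countable[OF ctble, of "{a<..<min d b}"] d(1) ab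
        by (metis greaterThanLessThan_empty_iff mem_Collect_eq min_less_iff_conj not_le open_greaterThanLessThan)
      obtain y where y: "y \<in> {b<..<b+e/2}" "isCont (cdf m) y"
        using open_minus_countable[OF ctble, of "{b<..<b+e/2}"] e by auto
      have "cdf m y - cdf m x \<le> y - x" using x y by (intro cont_le) auto
      moreover have "cdf m b \<le> cdf m y" using y by (intro m.cdf_nondecreasing) auto
      moreover have "cdf m x < cdf m a + e/2" using x d by auto
      ultimately show "cdf m b - cdf m a \<le> b - a + e" using x y by auto
    qed
  qed simp
qed

section \<open>Discretization on the grid of mesh \<open>1 / Suc n\<close>\<close>

definition grid :: "nat \<Rightarrow> real \<Rightarrow> real" where
  "grid n x = of_int \<lfloor>x * real (Suc n)\<rfloor> / real (Suc n)"

lemma grid_le: "grid n x \<le> x" and grid_gt: "x < grid n x + 1 / real (Suc n)"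
proof -
  have p: "real (Suc n) > 0" by simp
  have "of_int \<lfloor>x * real (Suc n)\<rfloor> \<le> x * real (Suc n)" by simp
  then show "grid n x \<le> x" unfolding grid_def using p by (simp add: pos_divide_le_eq)
  have "x * real (Suc n) < of_int \<lfloor>x * real (Suc n)\<rfloor> + 1" by linarith
  then have "x < (of_int \<lfloor>x * real (Suc n)\<rfloor> + 1) / real (Suc n)" using p by (simp add: pos_less_divide_eq)
  then show "x < grid n x + 1 / real (Suc n)" unfolding grid_def by (simp add: add_divide_distrib)
qed

lemma grid_measurable [measurable]: "grid n \<in> borel_measurable borel"
  unfolding grid_def by measurable

lemma grid_tendsto: "(\<lambda>n. grid n x) \<longlonglongrightarrow> x"
proof (rule tendsto_sandwich)
  show "(\<lambda>n. x - 1 / real (Suc n)) \<longlonglongrightarrow> x"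
    using tendsto_diff[OF tendsto_const LIMSEQ_inverse_real_of_nat, of x] by (simp add: inverse_eq_divide)
  show "\<forall>\<^sub>F n in sequentially. x - 1 / real (Suc n) \<le> grid n x"
    using grid_gt[of x] by (intro always_eventually allI) (smt (verit))
qed (auto simp: grid_le)

definition grid_points :: "real \<Rightarrow> nat \<Rightarrow> real set" where
  "grid_points R n = grid n ` {-R..R}"

lemma finite_grid_points: "finite (grid_points R n)"
proof -
  have "grid_points R n \<subseteq> (\<lambda>j. of_int j / real (Suc n)) ` {\<lfloor>-R * real (Suc n)\<rfloor>..\<lfloor>R * real (Suc n)\<rfloor>}"
    unfolding grid_points_def grid_def
  proof (rule image_subsetI)
    fix x assume "x \<in> {-R..R}"
    then have "-R \<le> x" "x \<le> R" by auto
    then have "-R * real (Suc n) \<le> x * real (Suc n)" "x * real (Suc n) \<le> R * real (Suc n)"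
      by (intro mult_right_mono; simp)+
    then show "of_int \<lfloor>x * real (Suc n)\<rfloor> / real (Suc n) \<in>
        (\<lambda>j. of_int j / real (Suc n)) ` {\<lfloor>-R * real (Suc n)\<rfloor>..\<lfloor>R * real (Suc n)\<rfloor>}"
      by (intro imageI) (auto intro!: floor_mono simp del: mult_minus_left of_nat_Suc)
  qed
  then show ?thesis by (rule finite_subset) simp
qed

lemma grid_points_bound: "a \<in> grid_points R n \<Longrightarrow> \<bar>a\<bar> \<le> R + 1"
proof -
  assume "a \<in> grid_points R n"
  then obtain x where x: "a = grid n x" "-R \<le> x" "x \<le> R" by (auto simp: grid_points_def)
  have "1 / real (Suc n) \<le> 1" by simp
  then show ?thesis using grid_le[of n x] grid_gt[of x n] x by linarith
qed

lemma grid_points_gap: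
  assumes "a \<in> grid_points R n" "b \<in> grid_points R n" "a < b"
  shows "a + 1 / real (Suc n) \<le> b"
proof -
  obtain i j :: int where ij: "a = of_int i / real (Suc n)" "b = of_int j / real (Suc n)"
    using assms by (auto simp: grid_points_def grid_def)
  with assms(3) have "i < j" by (simp add: divide_less_cancel)
  then have "of_int i + 1 \<le> (of_int j :: real)" by linarith
  then have "(of_int i + 1) / real (Suc n) \<le> of_int j / real (Suc n)" by (intro divide_right_mono) auto
  then show ?thesis by (simp add: ij add_divide_distrib)
qed

text \<open>The mass of the cell of length \<open>1 / Suc n\<close> starting at \<open>a\<close>. It
  is used both as the weight of an atom at \<open>a\<close> and as the length of an interval
  starting at \<open>a\<close>.\<close>

definition grid_mass :: "real measure \<Rightarrow> nat \<Rightarrow> real \<Rightarrow> real" where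
  "grid_mass m n a = measure m (grid n -` {a})"

lemma grid_mass_moment:
  assumes m: "supported_within R m"
  shows "(\<Sum>a\<in>grid_points R n. grid_mass m n a * a ^ k) = (\<integral>x. grid n x ^ k \<partial>m)"
proof -
  interpret real_distribution m using m by (simp add: supported_within_def)
  have vim [measurable]: "grid n -` {a} \<in> sets borel" for a
    using measurable_sets[OF grid_measurable, of "{a}" n] by simp
  have AE: "AE x in m. \<bar>x\<bar> \<le> R" using m by (simp add: supported_within_def)
  have "(\<integral>x. grid n x ^ k \<partial>m) = (\<integral>x. (\<Sum>a\<in>grid_points R n. indicator (grid n -` {a}) x * a ^ k) \<partial>m)"
  proof (rule integral_cong_AE)
    show "AE x in m. grid n x ^ k = (\<Sum>a\<in>grid_points R n. indicator (grid n -` {a}) x * a ^ k)"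
      using AE
    proof eventually_elim
      fix x :: real assume x: "\<bar>x\<bar> \<le> R"
      have "(\<Sum>a\<in>grid_points R n. indicator (grid n -` {a}) x * a ^ k) =
          (\<Sum>a\<in>grid_points R n. if a = grid n x then a ^ k else 0)"
        by (rule sum.cong) (auto split: split_indicator)
      also have "\<dots> = grid n x ^ k"
        using x by (subst sum.delta[OF finite_grid_points]) (auto simp: grid_points_def abs_le_iff)
      finally show "grid n x ^ k = (\<Sum>a\<in>grid_points R n. indicator (grid n -` {a}) x * a ^ k)" ..
    qed
  qed measurable
  also have "\<dots> = (\<Sum>a\<in>grid_points R n. grid_mass m n a * a ^ k)"
    by (subst Bochner_Integration.integral_sum)
       (auto simp: grid_mass_def intro!: integrable_mult_left integrable_real_indicator
         simp: emeasure_eq_measure)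
  finally show ?thesis ..
qed

lemma grid_mass_sum:
  assumes m: "supported_within R m"
  shows "(\<Sum>a\<in>grid_points R n. grid_mass m n a) = 1"
proof -
  interpret real_distribution m using m by (simp add: supported_within_def)
  show ?thesis using grid_mass_moment[OF m, of n 0] prob_space by simp
qed

lemma grid_mass_tendsto:
  assumes m: "supported_within R m"
  shows "(\<lambda>n. \<Sum>a\<in>grid_points R n. grid_mass m n a * a ^ k) \<longlonglongrightarrow> moment m k"
  unfolding grid_mass_moment[OF m] moment_def
proof (rule integral_dominated_convergence[where w="\<lambda>_. (R + 1) ^ k"])
  interpret real_distribution m using m by (simp add: supported_within_def)
  show "integrable m (\<lambda>_. (R + 1) ^ k)" by simp
  show "AE x in m. (\<lambda>n. grid n x ^ k) \<longlonglongrightarrow> x ^ k"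
    by (intro AE_I2 tendsto_power grid_tendsto)
  have AE: "AE x in m. \<bar>x\<bar> \<le> R" using m by (simp add: supported_within_def)
  show "AE x in m. norm (grid n x ^ k) \<le> (R + 1) ^ k" for n
    using AE
  proof eventually_elim
    fix x :: real assume "\<bar>x\<bar> \<le> R"
    then have "grid n x \<in> grid_points R n" by (auto simp: grid_points_def abs_le_iff)
    from grid_points_bound[OF this] show "norm (grid n x ^ k) \<le> (R + 1) ^ k"
      by (simp add: power_abs power_mono)
  qed
qed (use m in \<open>auto simp: supported_within_def real_distribution.events_eq_borel cong: measurable_cong_sets\<close>)

text \<open>This is where the density bound enters: an interval of length
  \<open>grid_mass m n a\<close> starting at \<open>a\<close> does not reach beyond its cell, so
  such intervals do not overlap.\<close>

lemma grid_mass_le: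
  assumes m: "cs_prob_density_le_1 m"
  shows "grid_mass m n a \<le> 1 / real (Suc n)"
proof -
  interpret real_distribution m using m by (simp add: cs_prob_density_le_1_def cs_prob_def)
  have vim [measurable]: "grid n -` {a} \<in> sets borel"
    using measurable_sets[OF grid_measurable, of "{a}" n] by simp
  have "ennreal (grid_mass m n a) = emeasure m (grid n -` {a})"
    by (simp add: grid_mass_def emeasure_eq_measure)
  also have "\<dots> \<le> emeasure lborel (grid n -` {a})"
    by (rule cs_prob_density_le_1_emeasure_le[OF m]) simp
  also have "\<dots> \<le> emeasure lborel {a..a + 1 / real (Suc n)}"
    by (intro emeasure_mono) (auto intro: grid_le less_imp_le[OF grid_gt] simp del: of_nat_Suc)
  also have "\<dots> = ennreal (1 / real (Suc n))" by simp
  finally show ?thesis by (simp add: ennreal_le_iff)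
qed

section \<open>Unions of intervals and atomic measures\<close>

lemma fps_power_nth_tendsto:
  fixes f :: "nat \<Rightarrow> real fps"
  assumes "\<And>k. (\<lambda>n. f n $ k) \<longlonglongrightarrow> g $ k"
  shows "(\<lambda>n. (f n ^ i) $ k) \<longlonglongrightarrow> (g ^ i) $ k"
  by (induction i arbitrary: k) (auto simp: fps_mult_nth intro!: tendsto_sum tendsto_mult assms)

lemma fps_compose_nth_tendsto:
  fixes f :: "nat \<Rightarrow> real fps"
  assumes "\<And>k. (\<lambda>n. f n $ k) \<longlonglongrightarrow> g $ k"
  shows "(\<lambda>n. (h oo f n) $ k) \<longlonglongrightarrow> (h oo g) $ k"
  unfolding fps_compose_nth by (intro tendsto_sum tendsto_mult tendsto_const fps_power_nth_tendsto assms)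

text \<open>Each coefficient of a solution is determined by the earlier ones. Identities between
  exponentials of series are reduced to this: both sides solve the same equation.\<close>

lemma fps_linear_ode_unique:
  fixes f g p :: "real fps"
  assumes "fps_deriv f = p * f" "fps_deriv g = p * g" "f $ 0 = g $ 0"
  shows "f = g"
proof (rule fps_ext)
  fix n show "f $ n = g $ n"
  proof (induction n rule: less_induct)
    case (less n)
    show ?case
    proof (cases n)
      case (Suc m)
      have "fps_deriv f $ m = fps_deriv g $ m"
        unfolding assms(1,2) fps_mult_nth using less Suc by (intro sum.cong) auto
      then show ?thesis using Suc by simp
    qed (use assms(3) in simp)
  qed
qed

lemma fps_exp_compose_deriv:
  "a $ 0 = 0 \<Longrightarrow> fps_deriv (fps_exp 1 oo a) = fps_deriv a * (fps_exp 1 oo (a :: real fps))"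
  by (simp add: fps_compose_deriv mult.commute)

lemma fps_exp_compose_add:
  fixes a b :: "real fps"
  assumes "a $ 0 = 0" "b $ 0 = 0"
  shows "fps_exp 1 oo (a + b) = (fps_exp 1 oo a) * (fps_exp 1 oo b)"
  by (rule fps_linear_ode_unique[where p="fps_deriv a + fps_deriv b"])
     (use assms in \<open>simp_all add: fps_exp_compose_deriv algebra_simps\<close>)

definition geometric :: "real \<Rightarrow> real fps" where
  "geometric a = Abs_fps (\<lambda>k. a ^ k)"

lemma geometric_mult: "geometric a * (1 - fps_const a * fps_X) = 1"
proof (rule fps_ext)
  fix n show "(geometric a * (1 - fps_const a * fps_X)) $ n = 1 $ n"
    by (cases n) (simp_all add: geometric_def algebra_simps)
qed

lemma fps_linear_mult_cancel:
  fixes f g :: "real fps"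
  shows "f * (1 - fps_const a * fps_X) = g * (1 - fps_const a * fps_X) \<longleftrightarrow> f = g"
proof
  assume "f * (1 - fps_const a * fps_X) = g * (1 - fps_const a * fps_X)"
  then have "f * ((1 - fps_const a * fps_X) * geometric a) = g * ((1 - fps_const a * fps_X) * geometric a)"
    by (simp only: mult.assoc[symmetric])
  then show "f = g" by (simp only: mult.commute[of _ "geometric a"] geometric_mult mult_1_right)
qed simp

text \<open>The moments of Lebesgue measure on \<open>[a, b]\<close>. For \<open>a = 0\<close>,
  multiplication by \<open>fps_X\<close> gives the series of \<open>- log (1 - b z)\<close>.\<close>

definition interval_moments :: "real \<Rightarrow> real \<Rightarrow> real fps" where
  "interval_moments a b = Abs_fps (\<lambda>k. (b ^ Suc k - a ^ Suc k) / real (Suc k))"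

lemma fps_exp_log_linear:
  "fps_exp 1 oo (- (fps_X * interval_moments 0 b)) = 1 - fps_const b * fps_X"
proof (rule fps_linear_ode_unique[where p="- fps_const b * geometric b"])
  have "fps_deriv (fps_X * interval_moments 0 b) = fps_const b * geometric b"
  proof (rule fps_ext)
    fix n show "fps_deriv (fps_X * interval_moments 0 b) $ n = (fps_const b * geometric b) $ n"
    proof -
      have "fps_deriv (fps_X * interval_moments 0 b) $ n = real (Suc n) * ((b ^ Suc n - 0 ^ Suc n) / real (Suc n))"
        unfolding fps_deriv_nth by (simp add: interval_moments_def del: of_nat_Suc power_Suc)
      also have "\<dots> = b ^ Suc n" by simp
      finally show ?thesis by (simp add: geometric_def)
    qed
  qed
  then show "fps_deriv (fps_exp 1 oo (- (fps_X * interval_moments 0 b))) =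
      - fps_const b * geometric b * (fps_exp 1 oo (- (fps_X * interval_moments 0 b)))"
    by (simp add: fps_exp_compose_deriv fps_const_neg[symmetric] del: fps_const_neg)
  show "fps_deriv (1 - fps_const b * fps_X) = - fps_const b * geometric b * (1 - fps_const b * fps_X)"
    unfolding mult.assoc geometric_mult by simp
qed simp

text \<open>The integral from \<open>a\<close> to \<open>b\<close> is the difference of those from 0
  to \<open>b\<close> and to \<open>a\<close>, so the exponential is
  \<open>(1 - b z) / (1 - a z)\<close>, stated here without division.\<close>

lemma fps_exp_interval_moments:
  "(fps_exp 1 oo (- (fps_X * interval_moments a b))) * (1 - fps_const a * fps_X) =
    1 - fps_const b * fps_X"
proof -
  have "interval_moments a b + interval_moments 0 a = interval_moments 0 b"
    by (rule fps_ext) (simp add: interval_moments_def diff_divide_distrib)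
  then have "- (fps_X * interval_moments 0 b) = - (fps_X * interval_moments a b) + - (fps_X * interval_moments 0 a)"
    by (simp only: distrib_left[symmetric] mult_minus_right[symmetric] minus_add_distrib[symmetric])
  then have "fps_exp 1 oo (- (fps_X * interval_moments 0 b)) =
      (fps_exp 1 oo (- (fps_X * interval_moments a b))) * (fps_exp 1 oo (- (fps_X * interval_moments 0 a)))"
    by (simp only:) (rule fps_exp_compose_add, simp_all)
  then show ?thesis by (simp only: fps_exp_log_linear)
qed

text \<open>\<open>c\<close> is the affine combination of \<open>a\<close> and \<open>b\<close> with
  coefficients \<open>(c - b) / (a - b)\<close> and \<open>(a - c) / (a - b)\<close>, and
  \<open>1 - c z\<close> is the same combination of \<open>1 - a z\<close> and
  \<open>1 - b z\<close>.\<close>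

lemma geometric_partial_fractions:
  assumes "a \<noteq> b"
  shows "(1 - fps_const c * fps_X) * geometric a =
    fps_const ((c - b) / (a - b)) + fps_const ((a - c) / (a - b)) * ((1 - fps_const b * fps_X) * geometric a)"
proof -
  define q p where "q = (c - b) / (a - b)" and "p = (a - c) / (a - b)"
  have "q + p = (a - b) / (a - b)" unfolding q_def p_def by (simp add: add_divide_distrib[symmetric])
  then have qp: "q + p = 1" using assms by simp
  have "q * a + p * b = ((c - b) * a + (a - c) * b) / (a - b)"
    unfolding q_def p_def by (simp add: add_divide_distrib)
  also have "(c - b) * a + (a - c) * b = c * (a - b)" by (simp add: algebra_simps)
  finally have c: "q * a + p * b = c" using assms by simp
  have "1 - fps_const c * fps_X =
      fps_const q * (1 - fps_const a * fps_X) + fps_const p * (1 - fps_const b * fps_X)"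
    (is "_ = ?r")
  proof -
    have "?r = fps_const (q + p) - fps_const (q * a + p * b) * fps_X"
    proof -
      have "q' * (1 - a' * x) + p' * (1 - b' * x) = (q' + p') - (q' * a' + p' * b') * x"
        for q' p' a' b' x :: "real fps" by (simp add: algebra_simps)
      then show ?thesis by (simp only: fps_const_add fps_const_mult)
    qed
    then show ?thesis by (simp add: qp c)
  qed
  then have "(1 - fps_const c * fps_X) * geometric a =
      fps_const q * ((1 - fps_const a * fps_X) * geometric a) +
      fps_const p * ((1 - fps_const b * fps_X) * geometric a)"
    by (simp only: distrib_right mult.assoc)
  also have "(1 - fps_const a * fps_X) * geometric a = 1" using geometric_mult[of a] by (simp only: mult.commute)
  finally show ?thesis by (simp add: q_def p_def)
qed

lemma fps_const_sum: "fps_const (\<Sum>a\<in>A. f a) = (\<Sum>a\<in>A. fps_const (f a))"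
  by (induction A rule: infinite_finite_induct) (simp_all add: fps_const_add[symmetric] del: fps_const_add)

text \<open>Multiplication by \<open>(1 - c z) / (1 - b z)\<close> moves the share
  \<open>(c - b) / (a - b)\<close> of each atom at \<open>a\<close> to a new atom at
  \<open>b\<close>, which also receives the length \<open>c - b\<close>. This is pure algebra,
  without sign conditions, so both directions of the correspondence can use it as their inductive
  step.\<close>

lemma interval_times_atoms:
  assumes A: "finite A" "b \<notin> A"
  shows "(fps_exp 1 oo (- (fps_X * interval_moments b c))) * (1 - fps_X * (\<Sum>a\<in>A. fps_const (w a) * geometric a)) =
    1 - fps_X * (fps_const (c - b + (\<Sum>a\<in>A. w a * ((c - b) / (a - b)))) * geometric b +
      (\<Sum>a\<in>A. fps_const (w a * ((a - c) / (a - b))) * geometric a))" (is "?F * ?P = ?Q")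
proof -
  define L where "L x = 1 - fps_const x * fps_X" for x :: real
  define K where "K = (\<Sum>a\<in>A. w a * ((c - b) / (a - b)))"
  define S where "S = (\<Sum>a\<in>A. fps_const (w a * ((a - c) / (a - b))) * geometric a)"
  note FL = fps_exp_interval_moments[of b c, folded L_def]
  have gL: "geometric b * L b = 1" using geometric_mult[of b] by (simp add: L_def)
  have pf: "L c * geometric a = fps_const ((c - b) / (a - b)) + fps_const ((a - c) / (a - b)) * (L b * geometric a)"
    if "a \<in> A" for a
    unfolding L_def by (rule geometric_partial_fractions) (use that A in auto)
  have Lc: "L c = L b - fps_const (c - b) * fps_X"
    by (simp add: L_def fps_const_sub[symmetric] left_diff_distrib del: fps_const_sub)
  have "L c * (\<Sum>a\<in>A. fps_const (w a) * geometric a) =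
      (\<Sum>a\<in>A. fps_const (w a) * (L c * geometric a))"
    by (simp only: sum_distrib_left mult.left_commute)
  also have "\<dots> = (\<Sum>a\<in>A. fps_const (w a * ((c - b) / (a - b))) +
      fps_const (w a * ((a - c) / (a - b))) * (L b * geometric a))"
    by (rule sum.cong) (simp_all only: pf distrib_left fps_const_mult mult.assoc[symmetric])
  also have "\<dots> = fps_const (\<Sum>a\<in>A. w a * ((c - b) / (a - b))) +
      L b * (\<Sum>a\<in>A. fps_const (w a * ((a - c) / (a - b))) * geometric a)"
    by (simp only: sum.distrib fps_const_sum sum_distrib_left mult.left_commute)
  also have "\<dots> = fps_const K + L b * S" by (simp only: K_def S_def)
  finally have sum: "L c * (\<Sum>a\<in>A. fps_const (w a) * geometric a) = fps_const K + L b * S" .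
  have "?F * ?P * L b = ?F * L b * ?P" by (simp only: mult_ac)
  also have "\<dots> = L c * ?P" by (simp only: FL)
  also have "\<dots> = L c - fps_X * (L c * (\<Sum>a\<in>A. fps_const (w a) * geometric a))"
    by (simp only: right_diff_distrib mult_1_right mult.left_commute[of "L c" fps_X])
  also have "\<dots> = L b - fps_X * (fps_const (c - b + K) + L b * S)"
    unfolding sum unfolding Lc
    by (simp only: fps_const_add[symmetric] distrib_left) (simp only: mult.commute diff_diff_add add.assoc)
  also have "\<dots> = L b - fps_X * (fps_const (c - b + K) * (geometric b * L b) + S * L b)"
    by (simp only: gL mult_1_right) (simp only: mult.commute)
  also have "\<dots> = ?Q * L b" unfolding K_def[symmetric] S_def[symmetric]
    by (simp only: left_diff_distrib mult_1_left distrib_left distrib_right mult.assoc)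
  finally show ?thesis unfolding L_def fps_linear_mult_cancel .
qed

lemma fps_exp_insert_interval:
  assumes "finite A" "b \<notin> A"
  shows "fps_exp 1 oo (- (fps_X * (\<Sum>a\<in>insert b A. interval_moments a (a + d a)))) =
    (fps_exp 1 oo (- (fps_X * interval_moments b (b + d b)))) *
    (fps_exp 1 oo (- (fps_X * (\<Sum>a\<in>A. interval_moments a (a + d a)))))"
  using assms by (subst fps_exp_compose_add[symmetric]) (simp_all add: distrib_left add.commute)

text \<open>Intervals are added from the right, each to the left of all earlier ones. Then
  \<open>b < a\<close> and \<open>c \<le> a\<close> for every old atom \<open>a\<close>, so both
  shares in \<open>interval_times_atoms\<close> are nonnegative; they add up to 1, so the total mass
  grows by \<open>c - b\<close>.\<close>

lemma atoms_of_intervals: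
  assumes "finite A" "\<And>a. a \<in> A \<Longrightarrow> d a \<ge> (0::real)"
    and "\<And>a b. a \<in> A \<Longrightarrow> b \<in> A \<Longrightarrow> a < b \<Longrightarrow> a + d a \<le> b"
  shows "\<exists>w. (\<forall>a\<in>A. w a \<ge> 0) \<and> (\<Sum>a\<in>A. w a) = (\<Sum>a\<in>A. d a) \<and>
    fps_exp 1 oo (- (fps_X * (\<Sum>a\<in>A. interval_moments a (a + d a)))) =
      1 - fps_X * (\<Sum>a\<in>A. fps_const (w a) * geometric a)"
  using assms
proof (induction A rule: finite_linorder_min_induct)
  case empty
  show ?case by simp
next
  case (insert b A)
  have bA: "b \<notin> A" using insert.hyps by auto
  obtain w where w: "\<forall>a\<in>A. w a \<ge> 0" "(\<Sum>a\<in>A. w a) = (\<Sum>a\<in>A. d a)"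
    "fps_exp 1 oo (- (fps_X * (\<Sum>a\<in>A. interval_moments a (a + d a)))) =
      1 - fps_X * (\<Sum>a\<in>A. fps_const (w a) * geometric a)"
    using insert.IH insert.prems by auto
  define c where "c = b + d b"
  have c: "b \<le> c" using insert.prems by (simp add: c_def)
  have cA: "c \<le> a" "b < a" if "a \<in> A" for a using insert.prems insert.hyps that by (auto simp: c_def)
  define w' where "w' a = (if a = b then c - b + (\<Sum>a\<in>A. w a * ((c - b) / (a - b)))
    else w a * ((a - c) / (a - b)))" for a
  have "\<forall>a\<in>insert b A. w' a \<ge> 0"
  proof
    fix a assume "a \<in> insert b A"
    then show "w' a \<ge> 0"
      using w(1) c cA by (auto simp: w'_def intro!: add_nonneg_nonneg sum_nonneg divide_nonneg_pos mult_nonneg_nonneg)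
  qed
  moreover have "(\<Sum>a\<in>insert b A. w' a) = (\<Sum>a\<in>insert b A. d a)"
  proof -
    have "(\<Sum>a\<in>A. w' a) = (\<Sum>a\<in>A. w a * ((a - c) / (a - b)))"
      using bA by (intro sum.cong) (auto simp: w'_def)
    then have "(\<Sum>a\<in>insert b A. w' a) = c - b + (\<Sum>a\<in>A. w a * ((c - b) / (a - b)) + w a * ((a - c) / (a - b)))"
      using insert.hyps bA by (simp add: w'_def sum.distrib)
    also have "(\<Sum>a\<in>A. w a * ((c - b) / (a - b)) + w a * ((a - c) / (a - b))) = (\<Sum>a\<in>A. w a)"
    proof (rule sum.cong)
      fix a assume "a \<in> A"
      have "w a * ((c - b) / (a - b)) + w a * ((a - c) / (a - b)) = w a * ((c - b + (a - c)) / (a - b))"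
        by (simp only: distrib_left add_divide_distrib)
      also have "\<dots> = w a" using cA(2)[OF \<open>a \<in> A\<close>] by simp
      finally show "w a * ((c - b) / (a - b)) + w a * ((a - c) / (a - b)) = w a" .
    qed simp
    finally show ?thesis using insert.hyps bA w(2) by (simp add: c_def)
  qed
  moreover have "fps_exp 1 oo (- (fps_X * (\<Sum>a\<in>insert b A. interval_moments a (a + d a)))) =
      1 - fps_X * (\<Sum>a\<in>insert b A. fps_const (w' a) * geometric a)"
  proof -
    have "(\<Sum>a\<in>A. fps_const (w' a) * geometric a) = (\<Sum>a\<in>A. fps_const (w a * ((a - c) / (a - b))) * geometric a)"
      using bA by (intro sum.cong) (auto simp: w'_def)
    then have "(\<Sum>a\<in>insert b A. fps_const (w' a) * geometric a) =
        fps_const (c - b + (\<Sum>a\<in>A. w a * ((c - b) / (a - b)))) * geometric b +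
        (\<Sum>a\<in>A. fps_const (w a * ((a - c) / (a - b))) * geometric a)"
      using insert.hyps bA by (simp add: w'_def)
    then show ?thesis
      unfolding fps_exp_insert_interval[OF insert.hyps(1) bA] w(3) c_def[symmetric]
        interval_times_atoms[OF insert.hyps(1) bA] by (simp only:)
  qed
  ultimately show ?case by (intro exI[of _ w'] conjI)
qed

text \<open>The right end \<open>c\<close> of the leftmost interval is the zero of \<open>1 - G\<close> between the two leftmost
  atoms, where \<open>G(z) = \<Sum> w a / (z - a)\<close>.\<close>
lemma leftmost_interval_end:
  fixes w :: "real \<Rightarrow> real"
  assumes A: "finite A" "\<forall>a\<in>A. b < a" and w: "\<And>a. a \<in> A \<Longrightarrow> w a > 0" "w0 > 0"
  obtains c where "b < c" "\<And>a. a \<in> A \<Longrightarrow> c < a" "(c - b) * (1 + (\<Sum>a\<in>A. w a / (a - c))) = w0"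
proof (cases "A = {}")
  case True
  then show ?thesis using that[of "b + w0"] w by simp
next
  case False
  define a0 where "a0 = Min A"
  have a0: "a0 \<in> A" "\<And>a. a \<in> A \<Longrightarrow> a0 \<le> a" using A False by (auto simp: a0_def)
  have ba0: "b < a0" using A a0 by auto
  have wa0: "w a0 > 0" using w a0 by auto
  \<comment> \<open>With this choice \<open>(c1 - b) * (w a0 / (a0 - c1))\<close> equals
    \<open>w0\<close>: the term of the nearest atom alone brings the function \<open>f\<close> below
    up to \<open>w0\<close> at \<open>c1\<close>, before its pole at \<open>a0\<close>.\<close>
  define e where "e = (a0 - b) * w a0 / (w a0 + w0)"
  define c1 where "c1 = a0 - e"
  have e: "e > 0" unfolding e_def using ba0 wa0 w by simp
  have eb: "a0 - b - e = (a0 - b) * w0 / (w a0 + w0)"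
    unfolding e_def using wa0 w by (simp add: field_simps)
  have "a0 - b - e > 0" unfolding eb using ba0 wa0 w(2) by (intro divide_pos_pos mult_pos_pos) auto
  then have bc1: "b < c1" by (simp add: c1_def)
  define f where "f c = (c - b) * (1 + (\<Sum>a\<in>A. w a / (a - c)))" for c
  have cont: "continuous_on {b..c1} f"
    unfolding f_def
  proof (intro continuous_intros ballI)
    fix c a assume "c \<in> {b..c1}" "a \<in> A"
    then show "a - c \<noteq> 0" using a0(2)[of a] e by (auto simp: c1_def)
  qed
  have "w0 = (c1 - b) * (w a0 / (a0 - c1))"
  proof -
    have "(c1 - b) * (w a0 / (a0 - c1)) = (a0 - b) * w0 / (w a0 + w0) * (w a0 / e)"
      unfolding eb[symmetric] by (simp add: c1_def)
    also have "\<dots> = w0"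
    proof -
      have "a0 - b \<noteq> 0" "w a0 \<noteq> 0" "w a0 + w0 \<noteq> 0" using ba0 wa0 w(2) by auto
      then show ?thesis unfolding e_def by simp
    qed
    finally show ?thesis ..
  qed
  also have "\<dots> \<le> f c1"
    unfolding f_def
  proof (rule mult_left_mono)
    have nn: "w a / (a - c1) \<ge> 0" if "a \<in> A" for a
      using w(1)[OF that] a0(2)[OF that] e by (intro divide_nonneg_pos) (auto simp: c1_def)
    have "w a0 / (a0 - c1) \<le> (\<Sum>a\<in>A. w a / (a - c1))"
      by (rule member_le_sum[where i=a0, OF a0(1)]) (use A nn in auto)
    then show "w a0 / (a0 - c1) \<le> 1 + (\<Sum>a\<in>A. w a / (a - c1))" by simp
  qed (use bc1 in simp)
  finally have fc1: "w0 \<le> f c1" .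
  have fb: "f b = 0" by (simp add: f_def)
  obtain c where c: "b \<le> c" "c \<le> c1" "f c = w0"
    using IVT'[of f b w0 c1] fb fc1 w bc1 cont by auto
  have "b < c" using c fb w(2) by (cases "b = c") auto
  moreover have "c < a" if "a \<in> A" for a using a0(2)[OF that] c e by (simp add: c1_def)
  ultimately show ?thesis using that c(3) by (simp add: f_def)
qed

text \<open>Dividing by the factor of the leftmost interval \<open>[b, c]\<close> must remove the
  atom at \<open>b\<close>, which is the equation for \<open>c\<close> in
  \<open>leftmost_interval_end\<close>. The other weights are multiplied by
  \<open>(a - b) / (a - c) > 0\<close>, so the induction hypothesis applies to them, and
  \<open>interval_times_atoms\<close> restores the original weights.\<close>

lemma intervals_of_atoms:
  assumes "finite A" "\<forall>a\<in>A. w a > (0::real)"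
  shows "\<exists>d. (\<forall>a\<in>A. d a \<ge> 0) \<and> (\<forall>a\<in>A. \<forall>b\<in>A. a < b \<longrightarrow> a + d a \<le> b) \<and>
    (\<Sum>a\<in>A. d a) = (\<Sum>a\<in>A. w a) \<and>
    fps_exp 1 oo (- (fps_X * (\<Sum>a\<in>A. interval_moments a (a + d a)))) =
      1 - fps_X * (\<Sum>a\<in>A. fps_const (w a) * geometric a)"
  using assms
proof (induction A arbitrary: w rule: finite_linorder_min_induct)
  case empty
  show ?case by simp
next
  case (insert b A)
  have bA: "b \<notin> A" using insert.hyps by auto
  obtain c where c: "b < c" "\<And>a. a \<in> A \<Longrightarrow> c < a" "(c - b) * (1 + (\<Sum>a\<in>A. w a / (a - c))) = w b"
    using leftmost_interval_end[OF insert.hyps, of w "w b"] insert.prems by auto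
  define w' where "w' a = w a * ((a - b) / (a - c))" for a
  have w': "\<forall>a\<in>A. w' a > 0"
    using c(1) c(2) insert.prems by (force simp: w'_def)
  have w'2: "w' a * ((a - c) / (a - b)) = w a" "w' a * ((c - b) / (a - b)) = (c - b) * (w a / (a - c))" if "a \<in> A" for a
    using c(1) c(2)[OF that] by (simp_all add: w'_def)
  obtain d where d: "\<forall>a\<in>A. d a \<ge> 0" "\<forall>a\<in>A. \<forall>b\<in>A. a < b \<longrightarrow> a + d a \<le> b" "(\<Sum>a\<in>A. d a) = (\<Sum>a\<in>A. w' a)"
    "fps_exp 1 oo (- (fps_X * (\<Sum>a\<in>A. interval_moments a (a + d a)))) =
      1 - fps_X * (\<Sum>a\<in>A. fps_const (w' a) * geometric a)"
    using insert.IH[of w', OF w'] by (elim exE conjE)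
  define d' where "d' = d(b := c - b)"
  have d'A: "(\<Sum>a\<in>A. g (d' a) a) = (\<Sum>a\<in>A. g (d a) a)" for g :: "real \<Rightarrow> real \<Rightarrow> 'b :: comm_monoid_add"
    using bA by (intro sum.cong) (auto simp: d'_def)
  have wb: "c - b + (\<Sum>a\<in>A. w' a * ((c - b) / (a - b))) = w b"
    using c(3) w'2(2) by (simp add: distrib_left sum_distrib_left)
  have wA: "(\<Sum>a\<in>A. fps_const (w' a * ((a - c) / (a - b))) * geometric a) = (\<Sum>a\<in>A. fps_const (w a) * geometric a)"
    by (rule sum.cong) (simp_all only: w'2(1))
  have "\<forall>a\<in>insert b A. d' a \<ge> 0" using d(1) c(1) by (auto simp: d'_def)
  moreover have "\<forall>a\<in>insert b A. \<forall>a'\<in>insert b A. a < a' \<longrightarrow> a + d' a \<le> a'"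
    using d(2) c insert.hyps(2) by (auto simp: d'_def intro: less_imp_le dest: less_asym)
  moreover have "(\<Sum>a\<in>insert b A. d' a) = (\<Sum>a\<in>insert b A. w a)"
  proof -
    have "(\<Sum>a\<in>A. w' a) = (\<Sum>a\<in>A. w' a * ((c - b) / (a - b)) + w' a * ((a - c) / (a - b)))"
    proof (rule sum.cong)
      fix a assume "a \<in> A"
      have "w' a * ((c - b) / (a - b)) + w' a * ((a - c) / (a - b)) = w' a * ((c - b + (a - c)) / (a - b))"
        by (simp only: distrib_left add_divide_distrib)
      also have "\<dots> = w' a" using c(1) c(2)[OF \<open>a \<in> A\<close>] by simp
      finally show "w' a = w' a * ((c - b) / (a - b)) + w' a * ((a - c) / (a - b))" ..
    qed simp
    also have "\<dots> = w b - (c - b) + (\<Sum>a\<in>A. w a)"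
      using wb w'2(1) by (simp add: sum.distrib)
    finally show ?thesis
      using insert.hyps bA d(3) d'A[of "\<lambda>x _. x"] by (simp add: d'_def)
  qed
  moreover have "fps_exp 1 oo (- (fps_X * (\<Sum>a\<in>insert b A. interval_moments a (a + d' a)))) =
      1 - fps_X * (\<Sum>a\<in>insert b A. fps_const (w a) * geometric a)"
  proof -
    have db: "b + d' b = c" by (simp add: d'_def)
    show ?thesis
      unfolding fps_exp_insert_interval[OF insert.hyps(1) bA] d'A[of "\<lambda>x a. interval_moments a (a + x)"] d(4) db
        interval_times_atoms[OF insert.hyps(1) bA] wb wA
      using insert.hyps bA by simp
  qed
  ultimately show ?case by (intro exI[of _ d'] conjI)
qed

section \<open>The map \<open>Q\<close> and its surjectivity\<close>

text \<open>Two applications of the mean value theorem. The error is quadratic in \<open>d\<close>: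
  if the lengths add up to 1 and each is at most \<open>1 / Suc n\<close>, replacing every interval
  by an atom at its left end costs only a multiple of \<open>1 / Suc n\<close>.\<close>

lemma interval_moments_approx:
  assumes d: "d \<ge> 0" and B: "\<bar>a\<bar> \<le> B" "\<bar>a + d\<bar> \<le> B"
  shows "\<bar>interval_moments a (a + d) $ k - d * a ^ k\<bar> \<le> d * d * (real k * B ^ (k - 1))"
proof (cases "d = 0")
  case False
  with d have d: "d > 0" by simp
  have "\<exists>z>a. z < a + d \<and> (a + d) ^ Suc k / real (Suc k) - a ^ Suc k / real (Suc k) = (a + d - a) * z ^ k"
  proof (rule MVT2)
    show "((\<lambda>x. x ^ Suc k / real (Suc k)) has_real_derivative x ^ k) (at x)" for x :: real
      using DERIV_cdivide[OF DERIV_pow[of "Suc k" x], of "real (Suc k)"] by (simp del: of_nat_Suc)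
  qed (use d in simp)
  then obtain z where z: "a < z" "z < a + d"
    "(a + d) ^ Suc k / real (Suc k) - a ^ Suc k / real (Suc k) = d * z ^ k" by auto
  have "\<exists>y>a. y < z \<and> z ^ k - a ^ k = (z - a) * (real k * y ^ (k - 1))"
    using z by (intro MVT2) (auto intro!: derivative_eq_intros)
  then obtain y where y: "a < y" "y < z" "z ^ k - a ^ k = (z - a) * (real k * y ^ (k - 1))" by auto
  have "interval_moments a (a + d) $ k - d * a ^ k = d * (z ^ k - a ^ k)"
    using z(3) by (simp add: interval_moments_def diff_divide_distrib right_diff_distrib)
  also have "\<bar>\<dots>\<bar> = d * ((z - a) * (real k * \<bar>y\<bar> ^ (k - 1)))"
    using d z(1) by (simp add: y(3) abs_mult power_abs)
  also have "\<dots> \<le> d * (d * (real k * B ^ (k - 1)))"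
    using d z y B by (intro mult_left_mono mult_mono power_mono) auto
  finally show ?thesis by (simp add: mult.assoc)
qed (simp add: interval_moments_def)

lemma grid_interval_moments_tendsto:
  assumes m: "cs_prob_density_le_1 m" "supported_within R m" and R: "R > 0"
  shows "(\<lambda>n. (\<Sum>a\<in>grid_points R n. interval_moments a (a + grid_mass m n a)) $ k) \<longlonglongrightarrow> moment m k"
proof -
  define C where "C = real k * (R + 2) ^ (k - 1)"
  have C: "C \<ge> 0" using R by (simp add: C_def)
  let ?I = "\<lambda>n. (\<Sum>a\<in>grid_points R n. interval_moments a (a + grid_mass m n a)) $ k"
  let ?S = "\<lambda>n. \<Sum>a\<in>grid_points R n. grid_mass m n a * a ^ k"
  have bound: "norm (?I n - ?S n) \<le> C * inverse (real (Suc n))" for n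
  proof -
    let ?d = "grid_mass m n"
    have "?I n - ?S n = (\<Sum>a\<in>grid_points R n. interval_moments a (a + ?d a) $ k - ?d a * a ^ k)"
      by (simp add: fps_sum_nth sum_subtractf)
    also have "\<bar>\<dots>\<bar> \<le> (\<Sum>a\<in>grid_points R n. \<bar>interval_moments a (a + ?d a) $ k - ?d a * a ^ k\<bar>)"
      by (rule sum_abs)
    also have "\<dots> \<le> (\<Sum>a\<in>grid_points R n. ?d a * (C * inverse (real (Suc n))))"
    proof (rule sum_mono)
      fix a assume a: "a \<in> grid_points R n"
      have d: "0 \<le> ?d a" "?d a \<le> 1 / real (Suc n)"
        using grid_mass_le[OF m(1)] by (auto simp: grid_mass_def)
      have "1 / real (Suc n) \<le> 1" by simp
      then have "?d a \<le> 1" using d(2) by linarith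
      then have "\<bar>a\<bar> \<le> R + 2" "\<bar>a + ?d a\<bar> \<le> R + 2" using grid_points_bound[OF a] d(1) by linarith+
      then have "\<bar>interval_moments a (a + ?d a) $ k - ?d a * a ^ k\<bar> \<le> ?d a * ?d a * C"
        unfolding C_def by (intro interval_moments_approx d)
      also have "\<dots> \<le> ?d a * (1 / real (Suc n)) * C"
        using d C by (intro mult_right_mono mult_left_mono) auto
      finally show "\<bar>interval_moments a (a + ?d a) $ k - ?d a * a ^ k\<bar> \<le> ?d a * (C * inverse (real (Suc n)))"
        by (simp only: inverse_eq_divide mult.assoc mult.commute[of C])
    qed
    also have "\<dots> = C * inverse (real (Suc n))"
      using grid_mass_sum[OF m(2), of n] by (simp only: sum_distrib_right[symmetric] mult_1_left)
    finally show ?thesis by simp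
  qed
  have lim: "(\<lambda>n. C * inverse (real (Suc n))) \<longlonglongrightarrow> 0"
    using tendsto_mult[OF tendsto_const LIMSEQ_inverse_real_of_nat, of C] by simp
  have "(\<lambda>n. ?I n - ?S n) \<longlonglongrightarrow> 0"
    by (rule Lim_null_comparison[OF always_eventually lim], rule allI, rule bound)
  from tendsto_add[OF this grid_mass_tendsto[OF m(2), of k]] show ?thesis by (simp only: diff_add_cancel add_0)
qed

lemma fps_X_mult_nth_tendsto:
  fixes f :: "nat \<Rightarrow> real fps"
  assumes "\<And>k. (\<lambda>n. f n $ k) \<longlonglongrightarrow> g $ k"
  shows "(\<lambda>n. (- (fps_X * f n)) $ k) \<longlonglongrightarrow> (- (fps_X * g)) $ k"
  using assms by (cases k) (auto intro!: tendsto_minus)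

lemma exp_moment_series_limit:
  assumes s: "\<And>k. (\<lambda>n. s n $ k) \<longlonglongrightarrow> moment r k"
    and c: "\<And>k. (\<lambda>n. c n $ k) \<longlonglongrightarrow> moment m k"
    and eq: "\<And>n. fps_exp 1 oo (- (fps_X * s n)) = 1 - fps_X * c n"
  shows "fps_exp 1 oo (- moment_series r) = 1 - moment_series m"
proof (rule fps_ext)
  fix k
  have "(\<lambda>n. (fps_exp 1 oo (- (fps_X * s n))) $ k) \<longlonglongrightarrow> (fps_exp 1 oo (- moment_series r)) $ k"
    unfolding moment_series_def using s by (intro fps_compose_nth_tendsto fps_X_mult_nth_tendsto) simp
  moreover have "(\<lambda>n. (1 + - (fps_X * c n)) $ k) \<longlonglongrightarrow> (1 + - (fps_X * Abs_fps (moment m))) $ k"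
    unfolding fps_add_nth using c by (intro tendsto_add tendsto_const fps_X_mult_nth_tendsto) simp
  ultimately show "(fps_exp 1 oo (- moment_series r)) $ k = (1 - moment_series m) $ k"
    unfolding eq moment_series_def by (simp add: LIMSEQ_unique)
qed

lemma geometric_sum_nth: "(\<Sum>a\<in>A. fps_const (w a) * geometric a) $ k = (\<Sum>a\<in>A. w a * a ^ k)"
  by (simp add: fps_sum_nth geometric_def)

lemma exp_moment_series_exists:
  assumes r: "cs_prob_density_le_1 r"
  shows "\<exists>m. cs_prob m \<and> fps_exp 1 oo (- moment_series r) = 1 - moment_series m"
proof -
  have cs: "cs_prob r" using r by (simp add: cs_prob_density_le_1_def)
  obtain R where R: "supported_within R r" "R > 0" using cs_prob_supported_within[OF cs] .
  define A where "A = grid_points R"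
  define s where "s n = (\<Sum>a\<in>A n. interval_moments a (a + grid_mass r n a))" for n
  have ex: "\<forall>n. \<exists>w. (\<forall>a\<in>A n. w a \<ge> 0) \<and> (\<Sum>a\<in>A n. w a) = (\<Sum>a\<in>A n. grid_mass r n a) \<and>
      fps_exp 1 oo (- (fps_X * s n)) = 1 - fps_X * (\<Sum>a\<in>A n. fps_const (w a) * geometric a)"
    unfolding s_def A_def
  proof (rule allI, rule atoms_of_intervals[OF finite_grid_points])
    fix n a b assume ab: "a \<in> grid_points R n" "b \<in> grid_points R n" "a < b"
    have "a + grid_mass r n a \<le> a + 1 / real (Suc n)" using grid_mass_le[OF r] by simp
    also have "\<dots> \<le> b" by (rule grid_points_gap[OF ab])
    finally show "a + grid_mass r n a \<le> b" .
  qed (simp add: grid_mass_def)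
  obtain w where "\<forall>n. (\<forall>a\<in>A n. w n a \<ge> 0) \<and> (\<Sum>a\<in>A n. w n a) = (\<Sum>a\<in>A n. grid_mass r n a) \<and>
      fps_exp 1 oo (- (fps_X * s n)) = 1 - fps_X * (\<Sum>a\<in>A n. fps_const (w n a) * geometric a)"
    by (rule exE[OF choice[OF ex]])
  then have w: "\<And>n a. a \<in> A n \<Longrightarrow> w n a \<ge> 0" "\<And>n. (\<Sum>a\<in>A n. w n a) = (\<Sum>a\<in>A n. grid_mass r n a)"
      "\<And>n. fps_exp 1 oo (- (fps_X * s n)) = 1 - fps_X * (\<Sum>a\<in>A n. fps_const (w n a) * geometric a)"
    by simp_all
  define c where "c n = (\<Sum>a\<in>A n. fps_const (w n a) * geometric a)" for n
  have "\<forall>n. \<exists>m. supported_within (R + 1) m \<and> (\<forall>k. moment m k = c n $ k)"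
  proof
    fix n
    obtain m where "supported_within (R + 1) m" "\<And>k. moment m k = (\<Sum>a\<in>A n. w n a * a ^ k)"
    proof (rule atomic_measure[of "A n" "w n" "\<lambda>a. a" "R + 1"])
      show "(\<Sum>a\<in>A n. w n a) = 1" using w(2) grid_mass_sum[OF R(1)] by (simp add: A_def)
    qed (auto simp: A_def finite_grid_points intro: w[unfolded A_def] grid_points_bound)
    then show "\<exists>m. supported_within (R + 1) m \<and> (\<forall>k. moment m k = c n $ k)"
      by (auto simp: c_def geometric_sum_nth)
  qed
  from choice[OF this]
  obtain M where M: "\<And>n. supported_within (R + 1) (M n)" "\<And>n k. moment (M n) k = c n $ k"
    by auto
  have s_lim: "(\<lambda>n. s n $ k) \<longlonglongrightarrow> moment r k" for k
    unfolding s_def A_def by (rule grid_interval_moments_tendsto[OF r R])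
  \<comment> \<open>The weights \<open>w\<close> are not explicit, but the moments they produce are
    coefficients of an exponential whose argument converges, so they converge too.\<close>
  have c_eq: "c n $ k = - ((fps_exp 1 oo (- (fps_X * s n))) $ Suc k)" for n k
    unfolding w(3) c_def[symmetric] by simp
  have c_lim: "(\<lambda>n. c n $ k) \<longlonglongrightarrow> - ((fps_exp 1 oo (- moment_series r)) $ Suc k)" for k
    unfolding c_eq moment_series_def using s_lim
    by (intro tendsto_minus fps_compose_nth_tendsto fps_X_mult_nth_tendsto) simp
  obtain m where m: "supported_within (R + 1) m"
    "\<And>k. moment m k = - ((fps_exp 1 oo (- moment_series r)) $ Suc k)"
  proof (rule moment_limit[of "R + 1" M])
    show "(\<lambda>n. moment (M n) k) \<longlonglongrightarrow> - ((fps_exp 1 oo (- moment_series r)) $ Suc k)" for k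
      using c_lim[of k] by (simp add: M)
  qed (use M R in auto)
  have "fps_exp 1 oo (- moment_series r) = 1 - moment_series m"
  proof (rule exp_moment_series_limit[OF s_lim])
    show "(\<lambda>n. c n $ k) \<longlonglongrightarrow> moment m k" for k using c_lim[of k] by (simp add: m)
  qed (simp add: w(3) c_def)
  with supported_within_imp_cs_prob[OF m(1)] show ?thesis by blast
qed

lemma interval_union_measure:
  assumes A: "finite A" and d: "\<And>a. a \<in> A \<Longrightarrow> d a \<ge> 0" "(\<Sum>a\<in>A. d a) = 1"
    and gap: "\<And>a b. a \<in> A \<Longrightarrow> b \<in> A \<Longrightarrow> a < b \<Longrightarrow> a + d a \<le> b"
    and R: "\<And>a. a \<in> A \<Longrightarrow> -R \<le> a" "\<And>a. a \<in> A \<Longrightarrow> a + d a \<le> R"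
  obtains r where "supported_within R r" "\<And>B. B \<in> sets borel \<Longrightarrow> emeasure r B \<le> emeasure lborel B"
    "\<And>k. moment r k = (\<Sum>a\<in>A. interval_moments a (a + d a)) $ k"
proof -
  \<comment> \<open>Half-open intervals stay disjoint even when they touch, so the density is
    bounded by 1 at every point.\<close>
  define g where "g x = (\<Sum>a\<in>A. indicator {a<..a + d a} x :: real)" for x
  have [measurable]: "g \<in> borel_measurable borel" unfolding g_def by measurable
  have g0: "g x \<ge> 0" for x by (simp add: g_def sum_nonneg)
  have g_out: "g x = 0" if "\<bar>x\<bar> > R" for x
    unfolding g_def using that R by (intro sum.neutral) (force split: split_indicator)
  have g1: "g x \<le> 1" for x
  proof (cases "\<exists>b\<in>A. x \<in> {b<..b + d b}")
    case True
    then obtain b where b: "b \<in> A" "b < x" "x \<le> b + d b" by auto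
    have "g x = (\<Sum>a\<in>A. if a = b then 1 else 0)"
      unfolding g_def
    proof (rule sum.cong)
      fix a assume a: "a \<in> A"
      show "indicator {a<..a + d a} x = (if a = b then 1 else (0::real))"
        using b gap[OF a b(1)] gap[OF b(1) a] by (cases a b rule: linorder_cases) (auto split: split_indicator)
    qed simp
    then show ?thesis using A b by simp
  next
    case False
    then have "g x = 0" unfolding g_def by (intro sum.neutral) auto
    then show ?thesis by simp
  qed
  define r where "r = density lborel (\<lambda>x. ennreal (g x))"
  have int: "has_bochner_integral lborel (\<lambda>x. g x * x ^ k) ((\<Sum>a\<in>A. interval_moments a (a + d a)) $ k)" for k
  proof -
    have "has_bochner_integral lborel (\<lambda>x. indicator {a<..a + d a} x * x ^ k) (interval_moments a (a + d a) $ k)"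
      if a: "a \<in> A" for a
    proof -
      have "has_bochner_integral lborel (\<lambda>x. x ^ k * indicator {a..a + d a} x) (interval_moments a (a + d a) $ k)"
        using integral_power[of a "a + d a" k] d(1)[OF a]
        by (auto simp: has_bochner_integral_iff interval_moments_def intro!: borel_integrable_atLeastAtMost)
      moreover have "AE x in lborel. x ^ k * indicator {a..a + d a} x = indicator {a<..a + d a} x * x ^ k"
        using AE_lborel_singleton[of a] by eventually_elim (auto split: split_indicator)
      ultimately show ?thesis by (subst (asm) has_bochner_integral_cong_AE) auto
    qed
    then show ?thesis
      unfolding g_def sum_distrib_right fps_sum_nth by (intro has_bochner_integral_sum)
  qed
  have total: "emeasure r (space r) = 1"
  proof -
    have "emeasure r (space r) = (\<integral>\<^sup>+x. ennreal (g x) \<partial>lborel)" unfolding r_def by (simp add: emeasure_density)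
    also have "\<dots> = ennreal ((\<Sum>a\<in>A. interval_moments a (a + d a)) $ 0)"
      using int[of 0] g0 by (subst nn_integral_eq_integral) (auto simp: has_bochner_integral_iff)
    also have "(\<Sum>a\<in>A. interval_moments a (a + d a)) $ 0 = 1" using d by (simp add: fps_sum_nth interval_moments_def)
    finally show ?thesis by simp
  qed
  have "supported_within R r"
    unfolding supported_within_def real_distribution_def real_distribution_axioms_def
  proof (intro conjI)
    show "prob_space r" by (rule prob_spaceI) (rule total)
    show "sets r = sets borel" by (simp add: r_def)
    have "AE x in lborel. 0 < ennreal (g x) \<longrightarrow> \<bar>x\<bar> \<le> R"
    proof (intro AE_I2 impI, rule ccontr)
      fix x assume "0 < ennreal (g x)" "\<not> \<bar>x\<bar> \<le> R"
      then show False using g_out[of x] by simp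
    qed
    then show "AE x in r. \<bar>x\<bar> \<le> R" unfolding r_def by (simp add: AE_density)
  qed
  moreover have "emeasure r B \<le> emeasure lborel B" if "B \<in> sets borel" for B
  proof -
    have "emeasure r B = (\<integral>\<^sup>+x. ennreal (g x) * indicator B x \<partial>lborel)"
      using that by (simp add: r_def emeasure_density)
    also have "\<dots> \<le> (\<integral>\<^sup>+x. indicator B x \<partial>lborel)"
      using g1 by (intro nn_integral_mono) (auto split: split_indicator)
    finally show ?thesis using that by simp
  qed
  moreover have "moment r k = (\<Sum>a\<in>A. interval_moments a (a + d a)) $ k" for k
    unfolding moment_def r_def
    using int[of k] g0 by (subst integral_density) (auto simp: has_bochner_integral_integral_eq)
  ultimately show ?thesis by (rule that)
qed

text \<open>Now the atoms are prescribed and the intervals are found. Convergence of moments would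
  not be enough here: a weak limit is taken because the bound by Lebesgue measure has to pass to
  it.\<close>

lemma exp_moment_series_surj:
  assumes m: "cs_prob m"
  shows "\<exists>r. cs_prob_density_le_1 r \<and> fps_exp 1 oo (- moment_series r) = 1 - moment_series m"
proof -
  obtain R where R: "supported_within R m" "R > 0" using cs_prob_supported_within[OF m] .
  \<comment> \<open>Empty cells are dropped because \<open>intervals_of_atoms\<close> asks for
    positive weights.\<close>
  define A where "A n = {a \<in> grid_points R n. grid_mass m n a \<noteq> 0}" for n
  have finA: "finite (A n)" for n by (simp add: A_def finite_grid_points)
  have sumA: "(\<Sum>a\<in>A n. grid_mass m n a * h a) = (\<Sum>a\<in>grid_points R n. grid_mass m n a * h a)" for n h
    by (rule sum.mono_neutral_left) (auto simp: A_def finite_grid_points)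
  define c where "c n = (\<Sum>a\<in>A n. fps_const (grid_mass m n a) * geometric a)" for n
  have c_lim: "(\<lambda>n. c n $ k) \<longlonglongrightarrow> moment m k" for k
    unfolding c_def geometric_sum_nth sumA by (rule grid_mass_tendsto[OF R(1)])
  have mass1: "(\<Sum>a\<in>A n. grid_mass m n a) = 1" for n
    using sumA[of n "\<lambda>_. 1"] grid_mass_sum[OF R(1)] by simp
  \<comment> \<open>Grid points lie within \<open>R + 1\<close>, and no interval is longer than the
    total length 1; hence \<open>R + 2\<close>.\<close>
  have ex: "\<forall>n. \<exists>r. supported_within (R + 2) r \<and> (\<forall>B\<in>sets borel. emeasure r B \<le> emeasure lborel B) \<and>
    fps_exp 1 oo (- (fps_X * Abs_fps (moment r))) = 1 - fps_X * c n" (is "\<forall>n. \<exists>r. ?P n r")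
  proof
    fix n
    have "\<forall>a\<in>A n. grid_mass m n a > 0" by (auto simp: A_def grid_mass_def zero_less_measure_iff)
    from intervals_of_atoms[OF finA this] obtain d where d: "\<forall>a\<in>A n. d a \<ge> 0"
      "\<forall>a\<in>A n. \<forall>b\<in>A n. a < b \<longrightarrow> a + d a \<le> b" "(\<Sum>a\<in>A n. d a) = (\<Sum>a\<in>A n. grid_mass m n a)"
      "fps_exp 1 oo (- (fps_X * (\<Sum>a\<in>A n. interval_moments a (a + d a)))) = 1 - fps_X * c n"
      unfolding c_def by (elim exE conjE)
    have d_sum: "(\<Sum>a\<in>A n. d a) = 1" using d(3) mass1 by simp
    have d1: "d a \<le> 1" if "a \<in> A n" for a
      using member_le_sum[of a "A n" d] that d(1) finA d_sum by auto
    obtain r where r: "supported_within (R + 2) r" "\<And>B. B \<in> sets borel \<Longrightarrow> emeasure r B \<le> emeasure lborel B"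
      "\<And>k. moment r k = (\<Sum>a\<in>A n. interval_moments a (a + d a)) $ k"
    proof (rule interval_union_measure[OF finA _ d_sum, of "R + 2"])
      fix a assume a: "a \<in> A n"
      then have b: "\<bar>a\<bar> \<le> R + 1" by (auto simp: A_def dest: grid_points_bound)
      show "- (R + 2) \<le> a" "a + d a \<le> R + 2" using b d1[OF a] by auto
      show "0 \<le> d a" using d(1) a by blast
    qed (use d(2) in auto)
    have "Abs_fps (moment r) = (\<Sum>a\<in>A n. interval_moments a (a + d a))"
      by (rule fps_ext) (simp add: r(3))
    then have "?P n r" using d(4) r(1,2) by simp
    then show "\<exists>r. ?P n r" ..
  qed
  from choice[OF ex] obtain M where M: "\<And>n. supported_within (R + 2) (M n)"
    "\<And>n B. B \<in> sets borel \<Longrightarrow> emeasure (M n) B \<le> emeasure lborel B"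
    "\<And>n. fps_exp 1 oo (- (fps_X * Abs_fps (moment (M n)))) = 1 - fps_X * c n"
    by auto
  have R2: "R + 2 \<ge> 0" using R by simp
  obtain h r where h: "strict_mono h" "supported_within (R + 2) r" "weak_conv_m (M \<circ> h) r"
    "\<And>k. (\<lambda>n. moment (M (h n)) k) \<longlonglongrightarrow> moment r k"
    by (rule helly_moments[where M=M, OF M(1) R2]) (rule that)
  have "cs_prob_density_le_1 r"
  proof (rule cs_prob_density_le_1I)
    show "cs_prob r" using h(2) by (rule supported_within_imp_cs_prob)
    fix B :: "real set" assume B: "B \<in> sets borel"
    show "emeasure r B \<le> emeasure lborel B"
      by (rule weak_limit_le_lborel[where M="M \<circ> h"])
         (use h(2,3) M(1,2) B in \<open>auto simp: supported_within_def\<close>)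
  qed
  moreover have "fps_exp 1 oo (- moment_series r) = 1 - moment_series m"
  proof (rule exp_moment_series_limit[where s="\<lambda>n. Abs_fps (moment (M (h n)))" and c="\<lambda>n. c (h n)"])
    show "(\<lambda>n. Abs_fps (moment (M (h n))) $ k) \<longlonglongrightarrow> moment r k" for k using h(4)[of k] by simp
    show "(\<lambda>n. c (h n) $ k) \<longlonglongrightarrow> moment m k" for k
      using LIMSEQ_subseq_LIMSEQ[OF c_lim h(1)] by (simp add: o_def)
  qed (rule M(3))
  ultimately show ?thesis by blast
qed

section \<open>Moments of symmetric matrices\<close>

lemma binomial_sum_Suc:
  fixes f :: "nat \<Rightarrow> real"
  shows "(\<Sum>i\<le>Suc N. real (Suc N choose i) * f i) = (\<Sum>i\<le>N. real (N choose i) * (f i + f (Suc i)))"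
proof -
  have "(\<Sum>i\<le>Suc N. real (Suc N choose i) * f i) =
      (\<Sum>i\<le>N. real (N choose i) * f (Suc i)) + (f 0 + (\<Sum>i\<le>N. real (N choose Suc i) * f (Suc i)))"
    by (simp only: sum.atMost_Suc_shift) (simp add: sum.distrib distrib_right)
  also have "f 0 + (\<Sum>i\<le>N. real (N choose Suc i) * f (Suc i)) = (\<Sum>i\<le>Suc N. real (N choose i) * f i)"
    by (simp only: sum.atMost_Suc_shift) simp
  also have "\<dots> = (\<Sum>i\<le>N. real (N choose i) * f i)" by (simp add: binomial_eq_0)
  finally show ?thesis by (simp add: sum.distrib distrib_left)
qed

text \<open>If \<open>d k m\<close> is the integral of \<open>x^k (1 - x)^m\<close>, this is the
  expansion of \<open>x^j (x + (1 - x))^N\<close>; the recurrence is all that the expansion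
  uses.\<close>

lemma difference_table_sum:
  fixes d :: "nat \<Rightarrow> nat \<Rightarrow> real"
  assumes "\<And>k m. d k (Suc m) = d k m - d (Suc k) m"
  shows "(\<Sum>i\<le>N. real (N choose i) * d (j + i) (N - i)) = d j 0"
proof (induction N)
  case (Suc N)
  have "(\<Sum>i\<le>Suc N. real (Suc N choose i) * d (j + i) (Suc N - i)) =
      (\<Sum>i\<le>N. real (N choose i) * (d (j + i) (Suc N - i) + d (j + Suc i) (Suc N - Suc i)))"
    by (rule binomial_sum_Suc)
  also have "\<dots> = (\<Sum>i\<le>N. real (N choose i) * d (j + i) (N - i))"
    by (rule sum.cong) (auto simp: Suc_diff_le assms)
  finally show ?case using Suc by simp
qed simp

text \<open>The quotient of binomials is the product of \<open>(k - i) / (n - i)\<close> over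
  \<open>i < j\<close>, to be compared factor by factor with \<open>k / n\<close>. All factors have
  absolute value at most 1, and \<open>2 * j \<le> n\<close> keeps \<open>n - i\<close> above
  \<open>n / 2\<close>.\<close>

lemma binomial_ratio_approx:
  assumes "2 * j \<le> n" "k \<le> n" "n > 0"
  shows "\<bar>(k / n) ^ j - real (k choose j) / real (n choose j)\<bar> \<le> real j * (2 * real j / real n)"
proof -
  have ratio: "real (k choose j) / real (n choose j) = (\<Prod>i<j. (real k - real i) / (real n - real i))"
    by (simp add: binomial_gbinomial gbinomial_prod_rev prod_dividef atLeast0LessThan)
  have n2: "real n \<le> 2 * (real n - real i)" "real i < real n" if "i < j" for i
  proof -
    have "2 * i \<le> n" "i < n" using that assms by auto
    then have "real (2 * i) \<le> real n" "real i < real n" by (simp_all only: of_nat_le_iff of_nat_less_iff)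
    then show "real n \<le> 2 * (real n - real i)" "real i < real n" by auto
  qed
  have "norm ((\<Prod>i<j. real k / real n) - (\<Prod>i<j. (real k - real i) / (real n - real i))) \<le>
      (\<Sum>i<j. norm (real k / real n - (real k - real i) / (real n - real i)))"
  proof (rule norm_prod_diff)
    fix i assume i: "i \<in> {..<j}"
    show "norm (real k / real n) \<le> 1" using assms by simp
    have "\<bar>real k - real i\<bar> \<le> real n - real i" using i assms by auto
    then show "norm ((real k - real i) / (real n - real i)) \<le> 1" using n2[of i] i by simp
  qed
  also have "\<dots> \<le> (\<Sum>i<j. 2 * real j / real n)"
  proof (rule sum_mono)
    fix i assume i: "i \<in> {..<j}"
    then have pos: "real n - real i > 0" using n2[of i] by simp
    have "real k / real n - (real k - real i) / (real n - real i) =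
        (real i / (real n - real i)) * ((real n - real k) / real n)"
      using pos assms by (simp add: divide_simps) (simp add: algebra_simps)
    also have "norm \<dots> \<le> (real i / (real n - real i)) * 1"
      unfolding norm_mult using pos assms by (intro mult_mono) auto
    also have "real i / (real n - real i) * 1 \<le> real j / (real n / 2)"
      unfolding mult_1_right using i assms n2[of i] by (intro frac_le) auto
    finally show "norm (real k / real n - (real k - real i) / (real n - real i)) \<le> 2 * real j / real n"
      by (simp add: mult.commute)
  qed
  finally show ?thesis by (simp add: ratio power_divide)
qed

text \<open>The approximating measures put the Bernstein weights \<open>l n k\<close> at the points
  \<open>k / n\<close>. With \<open>(k choose j) / (n choose j)\<close> in place of
  \<open>(k / n) ^ j\<close> their moments would be exactly \<open>d j 0\<close>, and the
  replacement costs \<open>O(1 / n)\<close>.\<close>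

lemma hausdorff_moment_problem:
  fixes d :: "nat \<Rightarrow> nat \<Rightarrow> real"
  assumes rec: "\<And>k m. d k (Suc m) = d k m - d (Suc k) m"
    and nonneg: "\<And>k m. d k m \<ge> 0" and d0: "d 0 0 = 1"
  obtains m where "supported_within 1 m" "\<And>k. moment m k = d k 0"
proof -
  define l where "l n k = real (n choose k) * d k (n - k)" for n k
  have l0: "l n k \<ge> 0" for n k by (simp add: l_def nonneg)
  have l_sum: "(\<Sum>k\<le>n. l n k) = 1" for n
    using difference_table_sum[where d=d and j=0 and N=n, OF rec] d0 by (simp add: l_def)
  have fact_moment: "(\<Sum>k\<le>n. l n k * (real (k choose j) / real (n choose j))) = d j 0" if jn: "j \<le> n" for n j
  proof -
    have "(\<Sum>k\<le>n. l n k * (real (k choose j) / real (n choose j))) =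
        (\<Sum>k\<in>{j..n}. l n k * (real (k choose j) / real (n choose j)))"
      by (rule sum.mono_neutral_right) (auto simp: binomial_eq_0)
    also have "\<dots> = (\<Sum>k\<in>{j..n}. real ((n - j) choose (k - j)) * d k (n - k))"
    proof (rule sum.cong)
      fix k assume "k \<in> {j..n}"
      then have "real (n choose k) * real (k choose j) = real (n choose j) * real ((n - j) choose (k - j))"
        using choose_mult[of j k n] by (simp flip: of_nat_mult)
      moreover have "real (n choose j) \<noteq> 0" using jn by simp
      ultimately have "real (n choose k) * (real (k choose j) / real (n choose j)) = real ((n - j) choose (k - j))"
        by (simp add: field_simps)
      then show "l n k * (real (k choose j) / real (n choose j)) = real ((n - j) choose (k - j)) * d k (n - k)"
        unfolding l_def by (metis (no_types) mult.commute mult.left_commute)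
    qed simp
    also have "\<dots> = (\<Sum>i\<le>n - j. real ((n - j) choose i) * d (j + i) (n - j - i))"
      using jn by (intro sum.reindex_bij_witness[of _ "\<lambda>i. j + i" "\<lambda>k. k - j"]) auto
    also have "\<dots> = d j 0" by (rule difference_table_sum[where d=d and j=j and N="n - j", OF rec])
    finally show ?thesis .
  qed
  have "\<forall>n. \<exists>m. supported_within 1 m \<and> (\<forall>j. moment m j = (\<Sum>k\<le>n. l n k * (real k / real n) ^ j))"
  proof
    fix n
    obtain m where "supported_within 1 m" "\<And>j. moment m j = (\<Sum>k\<le>n. l n k * (real k / real n) ^ j)"
    proof (rule atomic_measure[of "{..n}" "l n" "\<lambda>k. real k / real n" 1])
      show "\<bar>real k / real n\<bar> \<le> 1" if "k \<in> {..n}" for k using that by (cases "n = 0") auto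
    qed (use l0 l_sum in auto)
    then show "\<exists>m. supported_within 1 m \<and> (\<forall>j. moment m j = (\<Sum>k\<le>n. l n k * (real k / real n) ^ j))"
      by auto
  qed
  from choice[OF this] obtain M where M: "\<And>n. supported_within 1 (M n)"
    "\<And>n j. moment (M n) j = (\<Sum>k\<le>n. l n k * (real k / real n) ^ j)" by auto
  have lim: "(\<lambda>n. moment (M n) j) \<longlonglongrightarrow> d j 0" for j
  proof -
    have bound: "norm (moment (M n) j - d j 0) \<le> real j * (2 * real j / real n)" if n: "n \<ge> 2 * j + 1" for n
    proof -
      have "moment (M n) j - d j 0 =
          (\<Sum>k\<le>n. l n k * ((real k / real n) ^ j - real (k choose j) / real (n choose j)))"
        using fact_moment[of j n] n by (simp add: M(2) right_diff_distrib sum_subtractf)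
      also have "norm \<dots> \<le> (\<Sum>k\<le>n. l n k * (real j * (2 * real j / real n)))"
      proof (rule sum_norm_le)
        fix k assume "k \<in> {..n}"
        then have "\<bar>(real k / real n) ^ j - real (k choose j) / real (n choose j)\<bar> \<le> real j * (2 * real j / real n)"
          using n by (intro binomial_ratio_approx) auto
        then show "norm (l n k * ((real k / real n) ^ j - real (k choose j) / real (n choose j))) \<le>
            l n k * (real j * (2 * real j / real n))"
          unfolding real_norm_def abs_mult abs_of_nonneg[OF l0] by (rule mult_left_mono[OF _ l0])
      qed
      also have "\<dots> = real j * (2 * real j / real n)"
        using l_sum[of n] by (simp only: sum_distrib_right[symmetric] mult_1_left)
      finally show ?thesis .
    qed
    have null: "(\<lambda>n. real j * (2 * real j / real n)) \<longlonglongrightarrow> 0"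
      using tendsto_mult[OF tendsto_const lim_const_over_n, of "real j" "2 * real j"] by simp
    have "\<forall>\<^sub>F n in sequentially. norm (moment (M n) j - d j 0) \<le> real j * (2 * real j / real n)"
      by (rule eventually_mono[OF eventually_ge_at_top[of "2 * j + 1"]]) (rule bound)
    then have "(\<lambda>n. moment (M n) j - d j 0) \<longlonglongrightarrow> 0" by (rule Lim_null_comparison[OF _ null])
    then show ?thesis by (simp add: LIM_zero_iff)
  qed
  show ?thesis
    by (rule moment_limit[where M=M and R=1 and c="\<lambda>j. d j 0", OF M(1) _ lim]) (simp, rule that)
qed

section \<open>Spectral measure of a finite symmetric matrix\<close>

locale finite_symmetric_kernel =
  fixes A :: "'a set" and t :: "'a \<Rightarrow> 'a \<Rightarrow> real" and e :: 'a and R :: real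
  assumes finite_A: "finite A" and e_in: "e \<in> A" and R_pos: "R > 0"
    and sym: "\<And>a b. t a b = t b a"
    and row: "\<And>a. a \<in> A \<Longrightarrow> (\<Sum>b\<in>A. \<bar>t a b\<bar>) \<le> R"
begin

definition op :: "('a \<Rightarrow> real) \<Rightarrow> 'a \<Rightarrow> real" where
  "op f a = (\<Sum>b\<in>A. t a b * f b)"

definition ip :: "('a \<Rightarrow> real) \<Rightarrow> ('a \<Rightarrow> real) \<Rightarrow> real" where
  "ip f g = (\<Sum>a\<in>A. f a * g a)"

text \<open>Rescaling to \<open>0 \<le> X \<le> 1\<close> as quadratic forms, so that the moment
  problem on the unit interval applies; \<open>Y\<close> is \<open>1 - X\<close>.\<close>

definition X :: "('a \<Rightarrow> real) \<Rightarrow> 'a \<Rightarrow> real" where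
  "X f a = (op f a + R * f a) / (2 * R)"

definition Y :: "('a \<Rightarrow> real) \<Rightarrow> 'a \<Rightarrow> real" where
  "Y f a = f a - X f a"

lemma op_linear: "op (\<lambda>a. r * f a + s * g a) = (\<lambda>a. r * op f a + s * op g a)"
  by (rule ext) (simp add: op_def sum_distrib_left sum.distrib algebra_simps)

lemma X_linear: "X (\<lambda>a. r * f a + s * g a) = (\<lambda>a. r * X f a + s * X g a)"
  by (rule ext) (simp add: X_def op_linear add_divide_distrib[symmetric] algebra_simps)

lemma X_power_linear: "(X ^^ k) (\<lambda>a. r * f a + s * g a) = (\<lambda>a. r * (X ^^ k) f a + s * (X ^^ k) g a)"
  by (induction k) (simp_all add: X_linear)

lemma Y_eq: "Y f = (\<lambda>a. 1 * f a + (-1) * X f a)"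
  by (rule ext) (simp add: Y_def)

lemma op_eq: "op f = (\<lambda>a. (2 * R) * X f a + (- R) * f a)"
  using R_pos by (intro ext) (simp add: X_def)

lemma XY_commute: "X (Y f) = Y (X f)"
  by (simp only: Y_eq X_linear)

lemma ip_linear: "ip (\<lambda>a. r * f a + s * g a) h = r * ip f h + s * ip g h"
  by (simp add: ip_def sum_distrib_left sum.distrib algebra_simps)

lemma ip_commute: "ip f g = ip g f"
  by (simp add: ip_def mult.commute)

lemma op_selfadjoint: "ip (op f) g = ip f (op g)"
proof -
  have "ip (op f) g = (\<Sum>a\<in>A. \<Sum>b\<in>A. t a b * f b * g a)"
    by (simp add: ip_def op_def sum_distrib_right)
  also have "\<dots> = (\<Sum>b\<in>A. \<Sum>a\<in>A. t a b * f b * g a)" by (rule sum.swap)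
  also have "\<dots> = ip f (op g)"
    by (simp add: ip_def op_def sum_distrib_left sym mult_ac)
  finally show ?thesis .
qed

lemma X_selfadjoint: "ip (X f) g = ip f (X g)"
proof -
  have X: "X h = (\<lambda>a. (1 / (2 * R)) * op h a + (1 / 2) * h a)" for h
    using R_pos by (intro ext) (simp add: X_def field_simps)
  have "ip (X f) g = (1 / (2 * R)) * ip (op f) g + (1 / 2) * ip f g"
    unfolding X by (rule ip_linear)
  also have "\<dots> = (1 / (2 * R)) * ip (op g) f + (1 / 2) * ip g f"
    by (simp only: op_selfadjoint[of f] ip_commute[of f])
  also have "\<dots> = ip (X g) f" unfolding X by (rule ip_linear[symmetric])
  finally show ?thesis by (simp only: ip_commute)
qed

lemma Y_selfadjoint: "ip (Y f) g = ip f (Y g)"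
proof -
  have "ip (Y f) g = 1 * ip f g + (-1) * ip (X f) g" unfolding Y_eq by (rule ip_linear)
  also have "\<dots> = 1 * ip g f + (-1) * ip (X g) f" by (simp only: X_selfadjoint[of f] ip_commute[of f])
  also have "\<dots> = ip (Y g) f" unfolding Y_eq by (rule ip_linear[symmetric])
  finally show ?thesis by (simp only: ip_commute)
qed

text \<open>Schur test: \<open>2 \<bar>f a f b\<bar> \<le> f a ^ 2 + f b ^ 2\<close> reduces the form to the row sums.\<close>
lemma op_form_bound: "\<bar>ip (op f) f\<bar> \<le> R * ip f f"
proof -
  have "ip (op f) f = (\<Sum>a\<in>A. \<Sum>b\<in>A. t a b * f b * f a)"
    by (simp add: ip_def op_def sum_distrib_right)
  also have "\<bar>\<dots>\<bar> \<le> (\<Sum>a\<in>A. \<Sum>b\<in>A. \<bar>t a b\<bar> * ((f a)\<^sup>2 / 2) + \<bar>t a b\<bar> * ((f b)\<^sup>2 / 2))"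
  proof (rule order_trans[OF sum_abs], rule sum_mono, rule order_trans[OF sum_abs], rule sum_mono)
    fix a b
    have "2 * \<bar>f a\<bar> * \<bar>f b\<bar> \<le> (f a)\<^sup>2 + (f b)\<^sup>2"
      using sum_squares_bound[of "\<bar>f a\<bar>" "\<bar>f b\<bar>"] by simp
    moreover have "2 * \<bar>f a\<bar> * \<bar>f b\<bar> = 2 * \<bar>f b * f a\<bar>" by (simp add: abs_mult)
    ultimately have "\<bar>f b * f a\<bar> \<le> (f a)\<^sup>2 / 2 + (f b)\<^sup>2 / 2" by linarith
    then have "\<bar>t a b\<bar> * \<bar>f b * f a\<bar> \<le> \<bar>t a b\<bar> * ((f a)\<^sup>2 / 2 + (f b)\<^sup>2 / 2)"
      by (rule mult_left_mono) simp
    then show "\<bar>t a b * f b * f a\<bar> \<le> \<bar>t a b\<bar> * ((f a)\<^sup>2 / 2) + \<bar>t a b\<bar> * ((f b)\<^sup>2 / 2)"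
      by (simp add: abs_mult distrib_left mult.assoc)
  qed
  also have "\<dots> = (\<Sum>a\<in>A. \<Sum>b\<in>A. \<bar>t a b\<bar> * ((f a)\<^sup>2 / 2)) + (\<Sum>a\<in>A. \<Sum>b\<in>A. \<bar>t a b\<bar> * ((f b)\<^sup>2 / 2))"
    by (simp only: sum.distrib)
  also have "(\<Sum>a\<in>A. \<Sum>b\<in>A. \<bar>t a b\<bar> * ((f b)\<^sup>2 / 2)) = (\<Sum>a\<in>A. \<Sum>b\<in>A. \<bar>t a b\<bar> * ((f a)\<^sup>2 / 2))"
    by (subst sum.swap) (simp only: sym)
  also have "(\<Sum>a\<in>A. \<Sum>b\<in>A. \<bar>t a b\<bar> * ((f a)\<^sup>2 / 2)) \<le> (\<Sum>a\<in>A. R * ((f a)\<^sup>2 / 2))"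
    unfolding sum_distrib_right[symmetric] by (intro sum_mono mult_right_mono row) auto
  finally show ?thesis
    by (simp add: ip_def sum_distrib_left power2_eq_square sum.distrib[symmetric] flip: sum_divide_distrib)
qed

lemma X_nonneg: "ip (X f) f \<ge> 0" and Y_nonneg: "ip (Y f) f \<ge> 0"
proof -
  define q where "q = ip (op f) f / (2 * R)"
  have X: "ip (X f) f = q + ip f f / 2"
  proof -
    have "X f = (\<lambda>a. (1 / (2 * R)) * op f a + (1 / 2) * f a)"
      using R_pos by (intro ext) (simp add: X_def field_simps)
    then have "ip (X f) f = (1 / (2 * R)) * ip (op f) f + (1 / 2) * ip f f"
      by (simp only: ip_linear)
    then show ?thesis by (simp add: q_def)
  qed
  have "\<bar>q\<bar> = \<bar>ip (op f) f\<bar> / (2 * R)" using R_pos by (simp add: q_def abs_mult)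
  also have "\<dots> \<le> R * ip f f / (2 * R)" using op_form_bound[of f] R_pos by (intro divide_right_mono) auto
  finally have b: "\<bar>q\<bar> \<le> ip f f / 2" using R_pos by simp
  show "ip (X f) f \<ge> 0" using b X by simp
  have "ip (Y f) f = 1 * ip f f + (-1) * ip (X f) f" unfolding Y_eq by (rule ip_linear)
  then show "ip (Y f) f \<ge> 0" using b X by simp
qed

lemma ip_self_nonneg: "ip f f \<ge> 0"
  by (simp add: ip_def sum_nonneg)

text \<open>Since \<open>X + Y = 1\<close> and the two commute, \<open>X Y = X Y X + Y X Y\<close>;
  this avoids square roots of positive operators.\<close>

lemma XY_nonneg: "ip (X (Y f)) f \<ge> 0"
proof -
  have f: "f = (\<lambda>a. 1 * X f a + 1 * Y f a)" by (rule ext) (simp add: Y_def)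
  have "ip (X (Y f)) f = 1 * ip (X f) (X (Y f)) + 1 * ip (Y f) (X (Y f))"
    by (subst ip_commute, subst f, rule ip_linear)
  also have "ip (X f) (X (Y f)) = ip (Y (X f)) (X f)" by (simp only: XY_commute ip_commute)
  also have "ip (Y f) (X (Y f)) = ip (X (Y f)) (Y f)" by (rule ip_commute)
  finally show ?thesis using X_nonneg[of "Y f"] Y_nonneg[of "X f"] by simp
qed

lemma Y_power_X: "(Y ^^ m) (X f) = X ((Y ^^ m) f)"
  by (induction m) (simp_all add: XY_commute)

lemma X_power_Y: "(X ^^ j) (Y f) = Y ((X ^^ j) f)"
  by (induction j) (simp_all add: XY_commute)

text \<open>Moving one factor \<open>Y\<close> to the other argument lowers the exponent by two,
  which leaves exponents 0 and 1. The two conjuncts are the base cases for the same argument with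
  \<open>X\<close> in \<open>XY_form_nonneg\<close>.\<close>

lemma Y_form_nonneg: "ip ((Y ^^ m) f) f \<ge> 0 \<and> ip (X ((Y ^^ m) f)) f \<ge> 0"
proof (induction m arbitrary: f rule: induct_nat_012)
  case (ge2 m)
  have Y2: "(Y ^^ Suc (Suc m)) f = Y ((Y ^^ m) (Y f))" by (simp add: funpow_swap1)
  have "ip ((Y ^^ Suc (Suc m)) f) f = ip ((Y ^^ m) (Y f)) (Y f)"
    unfolding Y2 by (rule Y_selfadjoint)
  moreover have "ip (X ((Y ^^ Suc (Suc m)) f)) f = ip (X ((Y ^^ m) (Y f))) (Y f)"
    unfolding Y2 XY_commute by (rule Y_selfadjoint)
  ultimately show ?case using ge2(1)[of "Y f"] by simp
qed (simp_all add: ip_self_nonneg X_nonneg Y_nonneg XY_nonneg)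

lemma XY_form_nonneg: "ip ((X ^^ j) ((Y ^^ m) f)) f \<ge> 0"
proof (induction j arbitrary: f rule: induct_nat_012)
  case (ge2 j)
  have "(X ^^ Suc (Suc j)) ((Y ^^ m) f) = X ((X ^^ j) ((Y ^^ m) (X f)))"
    by (simp add: funpow_swap1 Y_power_X)
  then have "ip ((X ^^ Suc (Suc j)) ((Y ^^ m) f)) f = ip ((X ^^ j) ((Y ^^ m) (X f))) (X f)"
    by (simp only: X_selfadjoint)
  then show ?case using ge2(1)[of "X f"] by simp
qed (use Y_form_nonneg in simp_all)

definition unit_vec :: "'a \<Rightarrow> real" where
  "unit_vec a = (if a = e then 1 else 0)"

lemma ip_unit_vec: "ip f unit_vec = f e"
  using finite_A e_in by (simp add: ip_def unit_vec_def mult_delta_right)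

text \<open>The forms of \<open>X ^ j Y ^ m\<close> at the unit vector are a nonnegative difference
  table. Its measure is pushed forward by \<open>x \<mapsto> 2 R x - R\<close>, which undoes the
  rescaling; from \<open>\<bar>x\<bar> \<le> 1\<close> one gets the radius
  \<open>3 * R\<close>.\<close>

lemma spectral_measure:
  obtains m where "supported_within (3 * R) m" "\<And>k. moment m k = (op ^^ k) unit_vec e"
proof -
  define d where "d j m = ip ((X ^^ j) ((Y ^^ m) unit_vec)) unit_vec" for j m
  obtain m where m: "supported_within 1 m" "\<And>k. moment m k = d k 0"
  proof (rule hausdorff_moment_problem[of d])
    show "d k (Suc m) = d k m - d (Suc k) m" for k m
    proof -
      have "(X ^^ k) ((Y ^^ Suc m) unit_vec) = (\<lambda>a. 1 * (X ^^ k) ((Y ^^ m) unit_vec) a +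
          (-1) * (X ^^ Suc k) ((Y ^^ m) unit_vec) a)"
        by (simp add: X_power_Y Y_def fun_eq_iff)
      then have "d k (Suc m) = 1 * d k m + (-1) * d (Suc k) m" unfolding d_def by (simp only: ip_linear)
      then show ?thesis by simp
    qed
    show "d k m \<ge> 0" for k m unfolding d_def by (rule XY_form_nonneg)
    show "d 0 0 = 1" by (simp add: d_def ip_unit_vec) (simp add: unit_vec_def)
  qed (rule that)
  interpret m: real_distribution m using m(1) by (simp add: supported_within_def)
  \<comment> \<open>The extra factor \<open>x ^ j\<close> is needed for the induction on
    \<open>k\<close>, where each new factor \<open>2 * R * x - R\<close> raises the power of
    \<open>x\<close>.\<close>
  have pow: "(\<integral>x. x ^ j * (2 * R * x - R) ^ k \<partial>m) = ip ((X ^^ j) ((op ^^ k) unit_vec)) unit_vec" for j k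
  proof (induction k arbitrary: j)
    case 0
    show ?case using m(2)[of j] by (simp add: moment_def d_def)
  next
    case (Suc k)
    define g where "g = (op ^^ k) unit_vec"
    have int: "integrable m (\<lambda>x. x ^ i * (2 * R * x - R) ^ k)" for i
      by (intro supported_within_integrable[OF m(1)] continuous_intros)
    have "(\<integral>x. x ^ j * (2 * R * x - R) ^ Suc k \<partial>m) =
        (\<integral>x. 2 * R * (x ^ Suc j * (2 * R * x - R) ^ k) + (- R) * (x ^ j * (2 * R * x - R) ^ k) \<partial>m)"
      by (rule Bochner_Integration.integral_cong) (simp_all add: algebra_simps)
    also have "\<dots> = (2 * R) * (\<integral>x. x ^ Suc j * (2 * R * x - R) ^ k \<partial>m) +
        (- R) * (\<integral>x. x ^ j * (2 * R * x - R) ^ k \<partial>m)"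
      by (subst Bochner_Integration.integral_add) (auto intro!: integrable_mult_right int simp del: power_Suc)
    also have "\<dots> = (2 * R) * ip ((X ^^ Suc j) ((op ^^ k) unit_vec)) unit_vec +
        (- R) * ip ((X ^^ j) ((op ^^ k) unit_vec)) unit_vec"
      by (simp only: Suc.IH)
    also have "\<dots> = ip ((X ^^ j) (op g)) unit_vec"
    proof -
      have "(X ^^ j) (op g) = (\<lambda>a. (2 * R) * (X ^^ Suc j) g a + (- R) * (X ^^ j) g a)"
        unfolding op_eq[of g] X_power_linear by (simp add: funpow_swap1)
      then show ?thesis by (simp only: ip_linear g_def)
    qed
    finally show ?case by (simp add: g_def)
  qed
  define m' where "m' = distr m borel (\<lambda>x. 2 * R * x - R)"
  have "real_distribution m'" unfolding m'_def by (rule m.real_distribution_distr) simp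
  moreover have "AE x in m'. \<bar>x\<bar> \<le> 3 * R"
  proof -
    have "AE x in m. \<bar>x\<bar> \<le> 1" using m(1) by (simp add: supported_within_def)
    then have "AE x in m. \<bar>2 * R * x - R\<bar> \<le> 3 * R"
    proof eventually_elim
      fix x :: real assume "\<bar>x\<bar> \<le> 1"
      then have "R * \<bar>x\<bar> \<le> R * 1" using R_pos by (intro mult_left_mono) auto
      then have "\<bar>R * x\<bar> \<le> R" using R_pos by (simp add: abs_mult)
      then show "\<bar>2 * R * x - R\<bar> \<le> 3 * R" by (simp add: mult.assoc abs_le_iff)
    qed
    then show ?thesis unfolding m'_def by (subst AE_distr_iff) auto
  qed
  moreover have "moment m' k = (op ^^ k) unit_vec e" for k
    using pow[of 0 k] unfolding moment_def m'_def by (subst integral_distr) (auto simp: ip_unit_vec)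
  ultimately show ?thesis by (intro that[of m']) (simp_all add: supported_within_def)
qed

end

section \<open>Jacobi coefficients\<close>

locale jacobi =
  fixes m :: "real measure" and R :: real
  assumes supp: "supported_within R m"
begin

lemma integrable_continuous: "continuous_on UNIV f \<Longrightarrow> integrable m f" for f :: "real \<Rightarrow> real"
  by (rule supported_within_integrable[OF supp])

text \<open>The Stieltjes procedure. The triple holds the current orthogonal polynomial, its
  predecessor, and the off-diagonal coefficient that couples them; \<open>b\<close> is the diagonal
  coefficient.\<close>

primrec jac :: "nat \<Rightarrow> (real \<Rightarrow> real) \<times> (real \<Rightarrow> real) \<times> real" where
  "jac 0 = (\<lambda>_. 1, \<lambda>_. 0, 0)"
| "jac (Suc n) = (let (p, p', a) = jac n; b = (\<integral>x. x * (p x * p x) \<partial>m);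
     r = (\<lambda>x. x * p x - b * p x - a * p' x); a' = sqrt (\<integral>x. r x * r x \<partial>m)
   in (\<lambda>x. r x / a', p, a'))"

definition P :: "nat \<Rightarrow> real \<Rightarrow> real" where "P n = fst (jac n)"
definition P' :: "nat \<Rightarrow> real \<Rightarrow> real" where "P' n = fst (snd (jac n))"
definition a :: "nat \<Rightarrow> real" where "a n = snd (snd (jac n))"
definition b :: "nat \<Rightarrow> real" where "b n = (\<integral>x. x * (P n x * P n x) \<partial>m)"
definition r :: "nat \<Rightarrow> real \<Rightarrow> real" where "r n x = x * P n x - b n * P n x - a n * P' n x"

lemma P_0: "P 0 = (\<lambda>_. 1)" and P'_0: "P' 0 = (\<lambda>_. 0)" and a_0: "a 0 = 0"
  by (simp_all add: P_def P'_def a_def)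

lemma P'_Suc: "P' (Suc n) = P n"
  by (simp add: P_def P'_def Let_def split: prod.split)

lemma a_Suc: "a (Suc n) = sqrt (\<integral>x. r n x * r n x \<partial>m)"
  by (simp add: P_def P'_def a_def b_def r_def Let_def split: prod.split)

text \<open>If \<open>a (Suc n) = 0\<close> then \<open>m\<close> has finite support; division by zero makes all later polynomials,
  and hence all later coefficients, vanish.\<close>
lemma P_Suc: "P (Suc n) x = r n x / a (Suc n)"
  by (simp add: P_def P'_def a_def b_def r_def Let_def split: prod.split)

lemma continuous_P: "continuous_on UNIV (P n) \<and> continuous_on UNIV (P' n)"
proof (induction n)
  case (Suc n)
  have eq: "P (Suc n) = (\<lambda>x. (x * P n x - b n * P n x - a n * P' n x) * inverse (a (Suc n)))"
    by (rule ext) (simp add: P_Suc r_def divide_inverse)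
  have "continuous_on UNIV (P (Suc n))" unfolding eq by (intro continuous_intros) (use Suc in auto)
  with Suc show ?case by (simp add: P'_Suc)
qed (simp_all add: P_0 P'_0)

lemma continuous_P_intros [continuous_intros]:
  "continuous_on UNIV (P n)" "continuous_on UNIV (P' n)" "continuous_on UNIV (r n)"
proof -
  show P: "continuous_on UNIV (P n)" "continuous_on UNIV (P' n)" using continuous_P by auto
  have "continuous_on UNIV (\<lambda>x. x * P n x - b n * P n x - a n * P' n x)"
    by (intro continuous_intros P)
  then show "continuous_on UNIV (r n)" by (simp add: r_def[abs_def])
qed

text \<open>Dividing by zero does no harm: if the norm of \<open>r n\<close> vanishes, so does
  \<open>r n\<close> almost everywhere. The three-term recurrence therefore holds also for measures
  of finite support.\<close>

lemma r_eq: "AE x in m. r n x = a (Suc n) * P (Suc n) x"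
proof (cases "a (Suc n) = 0")
  case True
  then have "(\<integral>x. r n x * r n x \<partial>m) = 0" by (simp add: a_Suc)
  moreover have "integrable m (\<lambda>x. r n x * r n x)" by (intro integrable_continuous continuous_intros)
  ultimately have "AE x in m. r n x * r n x = 0" by (simp add: integral_nonneg_eq_0_iff_AE)
  then show ?thesis by eventually_elim (simp add: True)
qed (simp add: P_Suc)

lemma three_term: "AE x in m. x * P n x = a (Suc n) * P (Suc n) x + b n * P n x + a n * P' n x"
  using r_eq[of n] by eventually_elim (simp add: r_def algebra_simps)

lemma integral_three_term:
  assumes g: "continuous_on UNIV g"
  shows "(\<integral>x. x * P n x * g x \<partial>m) = a (Suc n) * (\<integral>x. P (Suc n) x * g x \<partial>m) +
    b n * (\<integral>x. P n x * g x \<partial>m) + a n * (\<integral>x. P' n x * g x \<partial>m)"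
proof -
  have int: "integrable m (\<lambda>x. P k x * g x)" "integrable m (\<lambda>x. P' k x * g x)"
    "integrable m (\<lambda>x. x * P k x * g x)" for k
    by (intro integrable_continuous continuous_intros g)+
  have "(\<integral>x. x * P n x * g x \<partial>m) =
      (\<integral>x. a (Suc n) * (P (Suc n) x * g x) + b n * (P n x * g x) + a n * (P' n x * g x) \<partial>m)"
  proof (rule integral_cong_AE)
    show "AE x in m. x * P n x * g x =
        a (Suc n) * (P (Suc n) x * g x) + b n * (P n x * g x) + a n * (P' n x * g x)"
      using three_term[of n] by eventually_elim (simp only: distrib_right mult.assoc)
    show "(\<lambda>x. x * P n x * g x) \<in> borel_measurable m" by (rule borel_measurable_integrable[OF int(3)])
    show "(\<lambda>x. a (Suc n) * (P (Suc n) x * g x) + b n * (P n x * g x) + a n * (P' n x * g x)) \<in> borel_measurable m"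
      by (intro borel_measurable_add borel_measurable_times borel_measurable_const borel_measurable_integrable[OF int(1)]
        borel_measurable_integrable[OF int(2)])
  qed
  also have "\<dots> = a (Suc n) * (\<integral>x. P (Suc n) x * g x \<partial>m) + b n * (\<integral>x. P n x * g x \<partial>m) + a n * (\<integral>x. P' n x * g x \<partial>m)"
    using int by simp
  finally show ?thesis .
qed

definition ip :: "nat \<Rightarrow> nat \<Rightarrow> real" where "ip i j = (\<integral>x. P i x * P j x \<partial>m)"

lemma ip_commute: "ip i j = ip j i"
  by (simp add: ip_def mult.commute)

lemma P_zero: "a (Suc n) = 0 \<Longrightarrow> P (Suc n) = (\<lambda>_. 0)"
  by (rule ext) (simp add: P_Suc)

lemma ip_self: "ip n n = (if n = 0 \<or> a n \<noteq> 0 then 1 else 0)"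
proof (cases n)
  case 0
  interpret real_distribution m using supp by (simp add: supported_within_def)
  show ?thesis using 0 prob_space by (simp add: ip_def P_0)
next
  case (Suc k)
  show ?thesis
  proof (cases "a n = 0")
    case True
    then show ?thesis using Suc by (simp add: ip_def P_zero)
  next
    case False
    have "(\<integral>x. r k x * r k x \<partial>m) \<ge> 0" by (simp add: integral_nonneg)
    then have sq: "a n * a n = (\<integral>x. r k x * r k x \<partial>m)" using Suc by (simp add: a_Suc)
    have "ip n n = (\<integral>x. (r k x * r k x) / (a n * a n) \<partial>m)"
      using Suc by (simp add: ip_def P_Suc)
    also have "\<dots> = (\<integral>x. r k x * r k x \<partial>m) / (a n * a n)" by simp
    also have "\<dots> = 1" using False sq[symmetric] by simp
    finally show ?thesis using False by simp
  qed
qed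

lemma a_nonzero_pred: "a (Suc (Suc n)) \<noteq> 0 \<Longrightarrow> a (Suc n) \<noteq> 0"
proof
  assume a: "a (Suc (Suc n)) \<noteq> 0" "a (Suc n) = 0"
  then have "r (Suc n) = (\<lambda>_. 0)" by (intro ext) (simp add: r_def P_zero)
  then have "a (Suc (Suc n)) = 0" by (simp only: a_Suc[of "Suc n"]) simp
  with a show False by simp
qed

lemma ip_self_pred: "a (Suc n) \<noteq> 0 \<Longrightarrow> ip n n = 1"
  by (cases n) (auto simp: ip_self dest: a_nonzero_pred)

lemma integral_P'_P: "(\<integral>x. P' n x * P j x \<partial>m) = (if n = 0 then 0 else ip (n - 1) j)"
  by (cases n) (simp_all add: P'_0 P'_Suc ip_def)

lemma shift_ip: "(\<integral>x. x * P n x * P j x \<partial>m) =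
    a (Suc n) * ip (Suc n) j + b n * ip n j + a n * (if n = 0 then 0 else ip (n - 1) j)"
  using integral_three_term[of "P j" n] continuous_P_intros(1)[of j]
  by (simp add: integral_P'_P flip: ip_def)

text \<open>Multiplication by \<open>x\<close> is symmetric, so \<open>P i\<close> can be expanded
  by its own recurrence instead of \<open>P k\<close>. Below \<open>i = k\<close> only
  \<open>i = k - 1\<close> contributes, and that is cancelled by the term with \<open>a k\<close>;
  the case \<open>i = k\<close> is cancelled by \<open>b k\<close>.\<close>

lemma orthogonal: "i < n \<Longrightarrow> ip n i = 0"
proof (induction n arbitrary: i rule: less_induct)
  case (less n)
  then obtain k where n: "n = Suc k" by (cases n) auto
  have IH: "ip j l = 0" if "j \<le> k" "l \<le> k" "j \<noteq> l" for j l
    using less.IH[of j l] less.IH[of l j] that n by (cases j l rule: linorder_cases) (auto simp: ip_commute)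
  show ?case
  proof (cases "a n = 0")
    case True
    then show ?thesis using n by (simp add: ip_def P_zero)
  next
    case False
    have kk: "ip k k = 1" using False n ip_self_pred by simp
    have int: "integrable m (\<lambda>x. x * P k x * P i x)" "integrable m (\<lambda>x. P k x * P i x)" "integrable m (\<lambda>x. P' k x * P i x)"
      by (intro integrable_continuous continuous_intros)+
    have "a n * ip n i = (\<integral>x. r k x * P i x \<partial>m)"
    proof -
      have "ip n i = (\<integral>x. r k x * P i x / a n \<partial>m)" using n by (simp add: ip_def P_Suc)
      then show ?thesis using False by simp
    qed
    also have "\<dots> = (\<integral>x. x * P k x * P i x - b k * (P k x * P i x) - a k * (P' k x * P i x) \<partial>m)"
      by (rule Bochner_Integration.integral_cong) (simp_all add: r_def algebra_simps)
    also have "\<dots> = (\<integral>x. x * P k x * P i x \<partial>m) - b k * ip k i - a k * (\<integral>x. P' k x * P i x \<partial>m)"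
      using int by (simp add: ip_def)
    also have "\<dots> = 0"
    proof (cases "i = k")
      case True
      have "(\<integral>x. P' k x * P k x \<partial>m) = 0" unfolding integral_P'_P using IH[of "k - 1" k] by simp
      moreover have "(\<integral>x. x * P k x * P k x \<partial>m) = b k" by (simp add: b_def mult.assoc)
      ultimately show ?thesis using True kk by simp
    next
      case ik: False
      then have i: "i < k" using less.prems n by simp
      have swap: "(\<integral>x. x * P k x * P i x \<partial>m) = (\<integral>x. x * P i x * P k x \<partial>m)"
        by (simp add: mult_ac)
      have "(\<integral>x. x * P i x * P k x \<partial>m) = a (Suc i) * ip (Suc i) k"
        unfolding shift_ip using i IH[of i k] IH[of "i - 1" k] by simp
      moreover have "a k * (\<integral>x. P' k x * P i x \<partial>m) = a (Suc i) * ip (Suc i) k"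
      proof (cases "Suc i = k")
        case True
        have "ip i i = 1" by (rule ip_self_pred) (use False n True a_nonzero_pred[of i] in auto)
        with True kk show ?thesis unfolding integral_P'_P by auto
      next
        case False
        with i have "Suc i < k" by simp
        then show ?thesis unfolding integral_P'_P using IH[of "k - 1" i] IH[of "Suc i" k] by auto
      qed
      ultimately show ?thesis using swap ik i IH[of k i] by simp
    qed
    finally show ?thesis using False by simp
  qed
qed

lemma ip_self_le: "ip n n \<le> 1"
  by (simp add: ip_self)

text \<open>The Jacobi coefficients are matrix entries of multiplication by \<open>x\<close>, hence
  bounded by the radius of the support; \<open>2 u v \<le> u^2 + v^2\<close> with norms at most 1
  serves as Cauchy-Schwarz.\<close>

lemma shift_ip_bound: "\<bar>\<integral>x. x * P i x * P j x \<partial>m\<bar> \<le> \<bar>R\<bar>"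
proof -
  have AE: "AE x in m. \<bar>x\<bar> \<le> R" using supp by (simp add: supported_within_def)
  have int: "integrable m (\<lambda>x. P k x * P k x)" "integrable m (\<lambda>x. x * P i x * P j x)" for k
    by (intro integrable_continuous continuous_intros)+
  have "\<bar>\<integral>x. x * P i x * P j x \<partial>m\<bar> \<le> (\<integral>x. \<bar>x * P i x * P j x\<bar> \<partial>m)"
    by (rule integral_abs_bound)
  also have "\<dots> \<le> (\<integral>x. \<bar>R\<bar> / 2 * (P i x * P i x) + \<bar>R\<bar> / 2 * (P j x * P j x) \<partial>m)"
  proof (rule integral_mono_AE)
    show "integrable m (\<lambda>x. \<bar>x * P i x * P j x\<bar>)" using int(2) by simp
    show "integrable m (\<lambda>x. \<bar>R\<bar> / 2 * (P i x * P i x) + \<bar>R\<bar> / 2 * (P j x * P j x))"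
      by (intro Bochner_Integration.integrable_add integrable_mult_right int)
    show "AE x in m. \<bar>x * P i x * P j x\<bar> \<le> \<bar>R\<bar> / 2 * (P i x * P i x) + \<bar>R\<bar> / 2 * (P j x * P j x)"
      using AE
    proof eventually_elim
      fix x :: real assume x: "\<bar>x\<bar> \<le> R"
      have "2 * \<bar>P i x\<bar> * \<bar>P j x\<bar> \<le> P i x * P i x + P j x * P j x"
        using sum_squares_bound[of "\<bar>P i x\<bar>" "\<bar>P j x\<bar>"] by (simp add: power2_eq_square)
      then have "\<bar>P i x\<bar> * \<bar>P j x\<bar> \<le> (P i x * P i x + P j x * P j x) / 2" by simp
      then have "\<bar>x\<bar> * (\<bar>P i x\<bar> * \<bar>P j x\<bar>) \<le> \<bar>R\<bar> * ((P i x * P i x + P j x * P j x) / 2)"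
        using x by (intro mult_mono) auto
      then show "\<bar>x * P i x * P j x\<bar> \<le> \<bar>R\<bar> / 2 * (P i x * P i x) + \<bar>R\<bar> / 2 * (P j x * P j x)"
        by (simp add: abs_mult algebra_simps)
    qed
  qed
  also have "\<dots> = \<bar>R\<bar> / 2 * ip i i + \<bar>R\<bar> / 2 * ip j j"
    using int(1) by (simp add: ip_def)
  also have "\<dots> \<le> \<bar>R\<bar> / 2 * 1 + \<bar>R\<bar> / 2 * 1"
    by (intro add_mono mult_left_mono ip_self_le) auto
  finally show ?thesis by simp
qed

lemma b_bound: "\<bar>b n\<bar> \<le> \<bar>R\<bar>"
  using shift_ip_bound[of n n] by (simp add: b_def mult.assoc)

lemma a_bound: "\<bar>a n\<bar> \<le> \<bar>R\<bar>"
proof (cases n)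
  case (Suc k)
  show ?thesis
  proof (cases "a n = 0")
    case False
    have 0: "ip k (Suc k) = 0" "(if k = 0 then 0 else ip (k - 1) (Suc k)) = 0"
      using orthogonal[of k "Suc k"] orthogonal[of "k - 1" "Suc k"] by (auto simp: ip_commute)
    have "(\<integral>x. x * P k x * P (Suc k) x \<partial>m) = a n"
      unfolding shift_ip 0 using Suc False by (simp add: ip_self)
    then show ?thesis using shift_ip_bound[of k "Suc k"] by simp
  qed simp
qed (simp add: a_0)

text \<open>The entry \<open>(n, 0)\<close> of the \<open>k\<close>-th power of the Jacobi matrix:
  \<open>q_0\<close> and \<open>q_Suc\<close> describe a weighted walk on the half line, whose
  returns to 0 are counted by the moments.\<close>

definition q :: "nat \<Rightarrow> nat \<Rightarrow> real" where "q n k = (\<integral>x. P n x * x ^ k \<partial>m)"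

lemma q_0: "q n 0 = (if n = 0 then 1 else 0)"
proof -
  have "q n 0 = ip n 0" by (simp add: q_def ip_def P_0)
  then show ?thesis using orthogonal[of 0 n] ip_self[of 0] by auto
qed

lemma q_Suc: "q n (Suc k) = a (Suc n) * q (Suc n) k + b n * q n k + (if n = 0 then 0 else a n * q (n - 1) k)"
proof -
  have "q n (Suc k) = (\<integral>x. x * P n x * x ^ k \<partial>m)" by (simp add: q_def mult_ac)
  also have "\<dots> = a (Suc n) * q (Suc n) k + b n * q n k + a n * (\<integral>x. P' n x * x ^ k \<partial>m)"
    unfolding q_def by (rule integral_three_term) (intro continuous_intros)
  also have "a n * (\<integral>x. P' n x * x ^ k \<partial>m) = (if n = 0 then 0 else a n * q (n - 1) k)"
    by (cases n) (simp_all add: P'_0 P'_Suc q_def)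
  finally show ?thesis .
qed

lemma q_moment: "q 0 k = moment m k"
  by (simp add: q_def P_0 moment_def)

end

lemma jacobi_coefficients:
  assumes "supported_within R m"
  obtains a b :: "nat \<Rightarrow> real" and q :: "nat \<Rightarrow> nat \<Rightarrow> real" where
    "\<And>n. \<bar>a n\<bar> \<le> \<bar>R\<bar>" "\<And>n. \<bar>b n\<bar> \<le> \<bar>R\<bar>" "\<And>n. q n 0 = (if n = 0 then 1 else 0)"
    "\<And>n k. q n (Suc k) = a (Suc n) * q (Suc n) k + b n * q n k + (if n = 0 then 0 else a n * q (n - 1) k)"
    "\<And>k. q 0 k = moment m k"
proof -
  interpret jacobi m R by unfold_locales (rule assms)
  show ?thesis by (rule that[of a b q]) (rule a_bound b_bound q_0 q_Suc q_moment)+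
qed

section \<open>Free convolution as a walk on a tree\<close>

lemma fps_X_times_shift: "f $ 0 = 0 \<Longrightarrow> f = fps_X * fps_shift 1 f" for f :: "real fps"
  by (rule fps_ext) (simp add: fps_X_mult_nth)

lemma fps_inv_nth_1: "f $ 0 = 0 \<Longrightarrow> f $ 1 = 1 \<Longrightarrow> fps_inv f $ 0 = 0 \<and> fps_inv f $ 1 = (1::real)"
  by (simp add: fps_inv_def)

lemma fps_X_mult_cancel: "fps_X * f = fps_X * g \<Longrightarrow> f = (g :: real fps)"
  by simp

text \<open>\<open>X * G\<close> is the series whose inverse is determined by additivity of the R-transform, and the
  subordination series \<open>X * C i\<close> satisfy \<open>(X * M i) oo (X * C i) = X * G\<close>.\<close>
lemma subordination_series:
  fixes M :: "bool \<Rightarrow> real fps"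
  assumes M: "\<And>i. M i $ 0 = 1"
  obtains G :: "real fps" and C :: "bool \<Rightarrow> real fps" where "G $ 0 = 1" "\<And>i. C i $ 0 = 1" "\<And>i. C i * (M i oo (fps_X * C i)) = G"
    "inverse (C True) + inverse (C False) = 1 + inverse G"
    "1 / fps_to_fls (fps_inv (fps_X * G)) - 1 / fls_X =
      (1 / fps_to_fls (fps_inv (fps_X * M True)) - 1 / fls_X) +
      (1 / fps_to_fls (fps_inv (fps_X * M False)) - 1 / fls_X)"
proof -
  define U where "U i = fps_inv (fps_X * M i)" for i
  define u where "u i = fps_shift 1 (U i)" for i
  have S01: "(fps_X * M i) $ 0 = 0" "(fps_X * M i) $ 1 = 1" for i using M by simp_all
  have U01: "U i $ 0 = 0" "U i $ 1 = 1" for i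
    using fps_inv_nth_1[OF S01] by (simp_all add: U_def)
  have U: "U i = fps_X * u i" for i unfolding u_def by (rule fps_X_times_shift[OF U01(1)])
  have u0: "u i $ 0 = 1" for i unfolding u_def by (simp only: fps_shift_nth U01 add_0)
  \<comment> \<open>With \<open>U i = fps_X * u i\<close>, additivity of the R-transform says that
    the inverse series \<open>V\<close> sought satisfies \<open>1 / V = h / fps_X\<close>.\<close>
  define h where "h = inverse (u True) + inverse (u False) - 1"
  have h0: "h $ 0 = 1" by (simp add: h_def u0)
  define V where "V = fps_X * inverse h"
  have V01: "V $ 0 = 0" "V $ 1 = 1" by (simp_all add: V_def h0)
  define S where "S = fps_inv V"
  have S01': "S $ 0 = 0" "S $ 1 = 1" using fps_inv_nth_1[OF V01] by (simp_all add: S_def)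
  define G where "G = fps_shift 1 S"
  have S: "S = fps_X * G" unfolding G_def by (rule fps_X_times_shift[OF S01'(1)])
  have G0: "G $ 0 = 1" using S01' by (simp add: G_def)
  have G_inv: "G * inverse G = 1" using G0 by (simp add: inverse_mult_eq_1')
  \<comment> \<open>Chosen so that \<open>fps_X * C i = U i oo S\<close>, the only series whose
    composition with \<open>fps_X * M i\<close> gives \<open>S\<close>.\<close>
  define C where "C i = G * (u i oo S)" for i
  have uS0: "(u i oo S) $ 0 = 1" for i by (simp add: u0)
  have C0: "C i $ 0 = 1" for i by (simp add: C_def G0 u0)
  have XC: "fps_X * C i = U i oo S" for i
  proof -
    have "fps_X * C i = S * (u i oo S)"
      by (simp only: C_def mult.assoc[symmetric] S[symmetric])
    also have "\<dots> = U i oo S"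
      by (simp only: U fps_compose_mult_distrib[OF S01'(1)] fps_X_fps_compose_startby0[OF S01'(1)])
    finally show ?thesis .
  qed
  have sub: "C i * (M i oo (fps_X * C i)) = G" for i
  proof (rule fps_X_mult_cancel)
    have C0': "(fps_X * C i) $ 0 = 0" by simp
    have "fps_X * (C i * (M i oo (fps_X * C i))) = (fps_X * M i) oo (fps_X * C i)"
      by (simp add: fps_compose_mult_distrib[OF C0'] mult.assoc)
    also have "\<dots> = ((fps_X * M i) oo U i) oo S"
      unfolding XC by (rule fps_compose_assoc[OF S01'(1) U01(1)])
    also have "(fps_X * M i) oo U i = fps_X"
      unfolding U_def by (rule fps_inv_right) (use S01 in auto)
    also have "fps_X oo S = fps_X * G" using S01' S by simp
    finally show "fps_X * (C i * (M i oo (fps_X * C i))) = fps_X * G" .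
  qed
  have hS: "h oo S = G"
  proof -
    have "fps_X = V oo S" unfolding S_def by (rule fps_inv_right[symmetric]) (use V01 in auto)
    also have "\<dots> = fps_X * (G * (inverse h oo S))"
      unfolding V_def fps_compose_mult_distrib[OF S01'(1)] using S01' by (simp add: S mult.assoc)
    finally have "fps_X * 1 = fps_X * (G * (inverse h oo S))" by simp
    then have 1: "G * (inverse h oo S) = 1" by (metis fps_X_mult_cancel)
    have "(h oo S) * (inverse h oo S) = (h * inverse h) oo S"
      by (rule fps_compose_mult_distrib[OF S01'(1), symmetric])
    also have "\<dots> = 1" using h0 by (simp add: inverse_mult_eq_1')
    finally have 2: "(h oo S) * (inverse h oo S) = 1" .
    have "h oo S = (h oo S) * (G * (inverse h oo S))" by (simp add: 1)
    also have "\<dots> = G * ((h oo S) * (inverse h oo S))" by (simp only: mult_ac)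
    finally show ?thesis by (simp add: 2)
  qed
  have "inverse (u True oo S) + inverse (u False oo S) - 1 = G"
    using hS u0 S01' by (simp add: h_def fps_compose_add_distrib fps_compose_sub_distrib fps_inverse_compose)
  then have sum: "inverse (u True oo S) + inverse (u False oo S) = 1 + G" by (simp add: algebra_simps)
  have "inverse (C i) = inverse (u i oo S) * inverse G" for i
    by (simp add: C_def fps_inverse_mult mult.commute)
  then have "inverse (C True) + inverse (C False) = (1 + G) * inverse G"
    by (simp add: sum[symmetric] distrib_right)
  then have inv_sum: "inverse (C True) + inverse (C False) = 1 + inverse G"
    using G_inv by (simp add: distrib_right add.commute)
  have fls: "1 / fps_to_fls (fps_X * f) = inverse fls_X * fps_to_fls (inverse f)" if "f $ 0 = 1" for f :: "real fps"
  proof -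
    have "f * inverse f = 1" using that by (simp add: inverse_mult_eq_1')
    then have "fps_to_fls f * fps_to_fls (inverse f) = 1"
      by (metis fls_times_fps_to_fls fps_one_to_fls)
    then have "inverse (fps_to_fls f) = fps_to_fls (inverse f)" by (rule inverse_unique)
    then show ?thesis by (simp add: fls_times_fps_to_fls divide_inverse)
  qed
  have invS: "fps_inv (fps_X * G) = fps_X * inverse h"
    unfolding S[symmetric] V_def[symmetric] unfolding S_def
    by (rule fps_inv_idempotent) (use V01 in auto)
  have invinv: "inverse (inverse h) = h" using h0 by simp
  have hfls: "fps_to_fls h = fps_to_fls (inverse (u True)) + fps_to_fls (inverse (u False)) - 1"
    by (simp only: h_def fps_to_fls_plus fps_to_fls_minus fps_one_to_fls)
  have fX: "1 / fls_X = inverse (fls_X :: real fls) * 1" by (simp add: divide_inverse)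
  have "1 / fps_to_fls (fps_inv (fps_X * G)) - 1 / fls_X =
      (1 / fps_to_fls (fps_inv (fps_X * M True)) - 1 / fls_X) +
      (1 / fps_to_fls (fps_inv (fps_X * M False)) - 1 / fls_X)"
    unfolding invS U_def[symmetric] U unfolding fls[OF u0] fX
    using h0 by (subst fls) (simp_all add: hfls algebra_simps)
  with G0 C0 sub inv_sum show ?thesis by (rule that)
qed

text \<open>Words grow at the head, away from the root: \<open>run i w\<close> is the position of
  \<open>w\<close> on its \<open>i\<close>-th half line, and \<open>strip i w\<close> the vertex
  where that half line starts.\<close>

definition run :: "bool \<Rightarrow> bool list \<Rightarrow> nat" where
  "run i w = length (takeWhile (\<lambda>x. x = i) w)"

definition strip :: "bool \<Rightarrow> bool list \<Rightarrow> bool list" where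
  "strip i w = dropWhile (\<lambda>x. x = i) w"

lemma run_Cons: "run i (j # w) = (if i = j then Suc (run i w) else 0)"
  by (simp add: run_def)

lemma strip_Cons: "strip i (j # w) = (if i = j then strip i w else j # w)"
  by (auto simp: strip_def)

lemma run_Nil [simp]: "run i [] = 0" and strip_Nil [simp]: "strip i [] = []"
  by (simp_all add: run_def strip_def)

lemma length_strip_le: "length (strip i w) \<le> length w"
  by (simp add: strip_def length_dropWhile_le)

text \<open>The free product of two copies of the half line, rooted at \<open>0\<close>, is the binary tree of words
  over \<open>bool\<close>: within a run of \<open>i\<close>'s one moves along the \<open>i\<close>-th half line.\<close>
locale tree_walk =
  fixes a b :: "bool \<Rightarrow> nat \<Rightarrow> real" and q :: "bool \<Rightarrow> nat \<Rightarrow> nat \<Rightarrow> real" and R :: real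
    and G :: "real fps" and C :: "bool \<Rightarrow> real fps"
  assumes R_pos: "R > 0"
    and a_bound: "\<And>i n. \<bar>a i n\<bar> \<le> R" and b_bound: "\<And>i n. \<bar>b i n\<bar> \<le> R"
    and q_0: "\<And>i n. q i n 0 = (if n = 0 then 1 else 0)"
    and q_Suc: "\<And>i n k. q i n (Suc k) = a i (Suc n) * q i (Suc n) k + b i n * q i n k +
      (if n = 0 then 0 else a i n * q i (n - 1) k)"
    and G_0: "G $ 0 = 1" and C_0: "\<And>i. C i $ 0 = 1"
    and sub: "\<And>i. C i * (Abs_fps (q i 0) oo (fps_X * C i)) = G"
    and inv_sum: "inverse (C True) + inverse (C False) = 1 + inverse G"
begin

definition Q :: "bool \<Rightarrow> nat \<Rightarrow> real fps" where "Q i n = Abs_fps (q i n)"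

lemma Q_eq: "Q i n = (if n = 0 then 1 else 0) + fps_X * (fps_const (a i (Suc n)) * Q i (Suc n) +
    fps_const (b i n) * Q i n + (if n = 0 then 0 else fps_const (a i n) * Q i (n - 1)))"
proof (rule fps_ext)
  fix k show "Q i n $ k = ((if n = 0 then 1 else 0) + fps_X * (fps_const (a i (Suc n)) * Q i (Suc n) +
    fps_const (b i n) * Q i n + (if n = 0 then 0 else fps_const (a i n) * Q i (n - 1)))) $ k"
    by (cases k) (auto simp: Q_def q_0 q_Suc)
qed

definition QC :: "bool \<Rightarrow> nat \<Rightarrow> real fps" where "QC i n = Q i n oo (fps_X * C i)"

lemma QC_eq: "QC i n = (if n = 0 then 1 else 0) + fps_X * C i * (fps_const (a i (Suc n)) * QC i (Suc n) +
    fps_const (b i n) * QC i n + (if n = 0 then 0 else fps_const (a i n) * QC i (n - 1)))"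
proof -
  have C: "(fps_X * C i) $ 0 = 0" by simp
  show ?thesis
    unfolding QC_def by (subst Q_eq) (simp add: fps_compose_add_distrib fps_compose_mult_distrib[OF C])
qed

lemma inverse_G: "G * inverse G = 1" and inverse_C: "C i * inverse (C i) = 1"
  using G_0 C_0 by (simp_all add: inverse_mult_eq_1')

text \<open>By \<open>sub\<close>, \<open>QC i 0\<close> is \<open>G * inverse (C i)\<close>, so
  this is \<open>QC i n / QC i 0\<close>: the half line resolvent at \<open>fps_X * C i\<close>,
  normalized to 1 at the start.\<close>

definition u :: "bool \<Rightarrow> nat \<Rightarrow> real fps" where "u i n = QC i n * C i * inverse G"

lemma u_0: "u i 0 = 1"
  using sub[of i] inverse_G by (simp add: u_def QC_def Q_def mult.commute)

text \<open>\<open>QC_eq\<close> times \<open>inverse G\<close>. The prefactor is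
  \<open>fps_X\<close> again, the same for both half lines, and the price is the factor
  \<open>inverse (C i)\<close> and the source \<open>inverse G\<close> on the right.\<close>

lemma u_eq: "fps_X * (fps_const (a i (Suc n)) * u i (Suc n) + fps_const (b i n) * u i n +
    (if n = 0 then 0 else fps_const (a i n) * u i (n - 1))) =
    u i n * inverse (C i) - (if n = 0 then inverse G else 0)"
proof -
  define J where "J = fps_const (a i (Suc n)) * QC i (Suc n) +
    fps_const (b i n) * QC i n + (if n = 0 then 0 else fps_const (a i n) * QC i (n - 1))"
  have "u i n * inverse (C i) = QC i n * inverse G * (C i * inverse (C i))"
    by (simp only: u_def mult_ac)
  also have "\<dots> = QC i n * inverse G" by (simp only: inverse_C mult_1_right)
  also have "QC i n = (if n = 0 then 1 else 0) + fps_X * C i * J"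
    unfolding J_def by (rule QC_eq)
  also have "((if n = 0 then 1 else 0) + fps_X * C i * J) * inverse G =
      (if n = 0 then inverse G else 0) + fps_X * (J * (C i * inverse G))"
  proof -
    have "(x + fps_X * c * j) * g = x * g + fps_X * (j * (c * g))" for x c j g :: "real fps"
      by (simp add: algebra_simps)
    then show ?thesis by simp
  qed
  also have "J * (C i * inverse G) = fps_const (a i (Suc n)) * u i (Suc n) + fps_const (b i n) * u i n +
      (if n = 0 then 0 else fps_const (a i n) * u i (n - 1))"
    by (simp add: J_def u_def distrib_right mult.assoc)
  finally show ?thesis by (simp only: add_diff_cancel_left')
qed

text \<open>A product ansatz with one factor for each maximal run; \<open>v_nth\<close> shows that
  it counts weighted walks between \<open>w\<close> and the root.\<close>

function v :: "bool list \<Rightarrow> real fps" where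
  "v [] = G"
| "v (i # w) = u i (Suc (run i w)) * v (strip i w)"
  by pat_completeness auto
termination by (relation "Wellfounded.measure length") (auto simp: le_imp_less_Suc length_strip_le)

text \<open>Either letter is allowed: if \<open>w\<close> does not start with \<open>i\<close>, the
  factor is \<open>u i 0 = 1\<close>.\<close>

lemma v_eq: "v w = u i (run i w) * v (strip i w)"
  by (cases w) (auto simp: run_Cons strip_Cons u_0)

definition walk1 :: "(bool list \<Rightarrow> real) \<Rightarrow> bool \<Rightarrow> bool list \<Rightarrow> real" where
  "walk1 f i w = a i (Suc (run i w)) * f (i # w) + b i (run i w) * f w +
    (if run i w = 0 then 0 else a i (run i w) * f (tl w))"

definition walk :: "(bool list \<Rightarrow> real) \<Rightarrow> bool list \<Rightarrow> real" where
  "walk f w = walk1 f True w + walk1 f False w"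

definition root :: "bool list \<Rightarrow> real" where
  "root w = (if w = [] then 1 else 0)"

lemma v_walk1: "fps_X * Abs_fps (\<lambda>k. walk1 (\<lambda>w. v w $ k) i w) =
    v w * inverse (C i) - (if run i w = 0 then v w * inverse G else 0)"
proof -
  define n where "n = run i w"
  define D where "D = v (strip i w)"
  have vw: "v w = u i n * D" unfolding n_def D_def by (rule v_eq)
  have viw: "v (i # w) = u i (Suc n) * D" by (simp add: n_def D_def)
  have vtl: "v (tl w) = u i (n - 1) * D" if "n \<noteq> 0"
  proof -
    from that obtain w' where w': "w = i # w'" by (cases w) (auto simp: n_def run_Cons split: if_splits)
    have "v w' = u i (run i w') * v (strip i w')" by (rule v_eq)
    then show ?thesis by (simp add: w' n_def D_def run_Cons strip_Cons)
  qed
  have "Abs_fps (\<lambda>k. walk1 (\<lambda>w. v w $ k) i w) = fps_const (a i (Suc n)) * v (i # w) + fps_const (b i n) * v w +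
      (if n = 0 then 0 else fps_const (a i n) * v (tl w))"
    by (rule fps_ext) (simp add: walk1_def n_def del: v.simps)
  also have "\<dots> = (fps_const (a i (Suc n)) * u i (Suc n) + fps_const (b i n) * u i n +
      (if n = 0 then 0 else fps_const (a i n) * u i (n - 1))) * D"
    using vtl by (simp add: vw viw distrib_right mult.assoc del: v.simps)
  also have "fps_X * \<dots> = (u i n * inverse (C i) - (if n = 0 then inverse G else 0)) * D"
    by (simp only: u_eq[symmetric] mult.assoc)
  also have "\<dots> = v w * inverse (C i) - (if n = 0 then v w * inverse G else 0)"
    by (simp add: vw u_0 algebra_simps)
  finally show ?thesis by (simp add: n_def)
qed

text \<open>By \<open>inv_sum\<close> the two half lines through \<open>w\<close> contribute
  \<open>v w * (1 + inverse G)\<close>, minus \<open>v w * inverse G\<close> for each one that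
  starts at \<open>w\<close>. Away from the root exactly one starts there and \<open>v w\<close>
  remains; at the root both do, leaving \<open>G - 1\<close>.\<close>

lemma v_resolvent: "v w = fps_const (root w) + fps_X * Abs_fps (\<lambda>k. walk (\<lambda>w. v w $ k) w)"
proof -
  have "Abs_fps (\<lambda>k. walk (\<lambda>w. v w $ k) w) =
      Abs_fps (\<lambda>k. walk1 (\<lambda>w. v w $ k) True w) + Abs_fps (\<lambda>k. walk1 (\<lambda>w. v w $ k) False w)"
    by (rule fps_ext) (simp add: walk_def)
  then have "fps_X * Abs_fps (\<lambda>k. walk (\<lambda>w. v w $ k) w) =
      v w * (inverse (C True) + inverse (C False)) -
      ((if run True w = 0 then v w * inverse G else 0) + (if run False w = 0 then v w * inverse G else 0))"
    by (simp only: distrib_left v_walk1) (simp add: algebra_simps)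
  also have "\<dots> = v w - fps_const (root w)"
  proof (cases w)
    case Nil
    show ?thesis unfolding inv_sum using inverse_G by (simp add: Nil root_def algebra_simps)
  next
    case (Cons j w')
    show ?thesis unfolding inv_sum by (cases j) (simp_all add: Cons root_def run_Cons algebra_simps del: v.simps)
  qed
  finally show ?thesis by simp
qed

lemma v_nth: "v w $ k = (walk ^^ k) root w"
proof (induction k arbitrary: w)
  case 0
  show ?case by (subst v_resolvent) simp
next
  case (Suc k)
  have "v w $ Suc k = walk (\<lambda>w. v w $ k) w" by (subst v_resolvent) simp
  also have "(\<lambda>w. v w $ k) = (walk ^^ k) root" using Suc.IH by (rule ext)
  finally show ?case by simp
qed

lemma G_nth: "G $ k = (walk ^^ k) root []"
  using v_nth[of "[]" k] by simp

section \<open>The walk as a symmetric matrix and its truncations\<close>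

definition diag :: "bool list \<Rightarrow> real" where
  "diag w = b True (run True w) + b False (run False w)"

definition up :: "bool list \<Rightarrow> real" where
  "up w = (if w = [] then 0 else a (hd w) (run (hd w) w))"

definition kernel :: "bool list \<Rightarrow> bool list \<Rightarrow> real" where
  "kernel w w' = (if w = w' then diag w else 0) +
    (if w \<noteq> [] \<and> w' = tl w then up w else 0) + (if w' \<noteq> [] \<and> w = tl w' then up w' else 0)"

lemma kernel_sym: "kernel w w' = kernel w' w"
  by (simp add: kernel_def)

lemma walk_eq: "walk f w = diag w * f w + up w * f (tl w) + (up (True # w) * f (True # w) + up (False # w) * f (False # w))"
  by (cases w) (auto simp: walk_def walk1_def diag_def up_def run_Cons algebra_simps)

lemma kernel_eq: "kernel w w' = (if w' = w then diag w else 0) + (if w' = tl w then up w else 0) +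
    ((if w' = True # w then up (True # w) else 0) + (if w' = False # w then up (False # w) else 0))"
proof (cases w')
  case Nil
  then show ?thesis by (auto simp: kernel_def up_def)
next
  case (Cons j w'')
  then show ?thesis by (cases j) (auto simp: kernel_def up_def)
qed

definition words :: "nat \<Rightarrow> bool list set" where
  "words N = {w. length w \<le> N}"

lemma finite_words: "finite (words N)"
  using finite_lists_length_le[of "UNIV :: bool set" N] by (simp add: words_def)

lemma kernel_sum:
  assumes "w \<in> words N"
  shows "(\<Sum>w'\<in>words N. kernel w w' * f w') = diag w * f w + up w * f (tl w) +
    ((if length w < N then up (True # w) * f (True # w) else 0) +
     (if length w < N then up (False # w) * f (False # w) else 0))"
proof -
  have *: "(\<Sum>w'\<in>words N. (if w' = x then c else 0) * f w') = (if x \<in> words N then c * f x else 0)" for x c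
  proof -
    have "(\<Sum>w'\<in>words N. (if w' = x then c else 0) * f w') = (\<Sum>w'\<in>words N. if w' = x then c * f w' else 0)"
      by (rule sum.cong) auto
    then show ?thesis by (simp add: finite_words)
  qed
  have "tl w \<in> words N" using assms by (simp add: words_def)
  moreover have "(x # w \<in> words N) = (length w < N)" for x by (auto simp: words_def)
  ultimately show ?thesis
    using assms unfolding kernel_eq distrib_right sum.distrib * by simp
qed

lemma up_bound: "\<bar>up w\<bar> \<le> R"
  using a_bound R_pos by (simp add: up_def)

text \<open>The diagonal has two summands and a vertex has at most three neighbours, its parent and
  two children: five entries bounded by \<open>R\<close>.\<close>

lemma kernel_row_bound:
  assumes "w \<in> words N"
  shows "(\<Sum>w'\<in>words N. \<bar>kernel w w'\<bar>) \<le> 5 * R"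
proof -
  have *: "(\<Sum>w'\<in>words N. if w' = x then \<bar>c\<bar> else 0) \<le> \<bar>c\<bar>" for x and c :: real
    by (simp add: finite_words)
  have "(\<Sum>w'\<in>words N. \<bar>kernel w w'\<bar>) \<le> (\<Sum>w'\<in>words N. (if w' = w then \<bar>diag w\<bar> else 0) + (if w' = tl w then \<bar>up w\<bar> else 0) +
    ((if w' = True # w then \<bar>up (True # w)\<bar> else 0) + (if w' = False # w then \<bar>up (False # w)\<bar> else 0)))"
    unfolding kernel_eq by (intro sum_mono order_trans[OF abs_triangle_ineq] add_mono) auto
  also have "\<dots> \<le> \<bar>diag w\<bar> + \<bar>up w\<bar> + (\<bar>up (True # w)\<bar> + \<bar>up (False # w)\<bar>)"
    unfolding sum.distrib by (intro add_mono *)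
  also have "\<dots> \<le> 2 * R + R + (R + R)"
  proof (intro add_mono up_bound)
    show "\<bar>diag w\<bar> \<le> 2 * R"
      unfolding diag_def using b_bound[of True "run True w"] b_bound[of False "run False w"] by linarith
  qed
  finally show ?thesis by simp
qed

lemma walk_support: "length w > k \<Longrightarrow> (walk ^^ k) root w = 0"
proof (induction k arbitrary: w)
  case 0
  then show ?case by (auto simp: root_def)
next
  case (Suc k)
  then have "(walk ^^ k) root w = 0" "(walk ^^ k) root (tl w) = 0" "(walk ^^ k) root (x # w) = 0" for x
    by auto
  then show ?case by (simp add: walk_eq[of "(walk ^^ k) root"])
qed

lemma finite_kernel: "finite_symmetric_kernel (words N) kernel [] (5 * R)"
proof
  show "finite (words N)" by (rule finite_words)
  show "[] \<in> words N" by (simp add: words_def)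
  show "5 * R > 0" using R_pos by simp
qed (rule kernel_sym kernel_row_bound; assumption)+

text \<open>Truncation cuts only the edges from length \<open>N\<close> to \<open>N + 1\<close>. In
  the step to \<open>Suc k \<le> N\<close> these would carry values at words longer than
  \<open>k\<close>, which are 0 by \<open>walk_support\<close>.\<close>

lemma truncated_walk:
  assumes "k \<le> N" "w \<in> words N"
  shows "(finite_symmetric_kernel.op (words N) kernel ^^ k) root w = (walk ^^ k) root w"
  using assms
proof (induction k arbitrary: w)
  case (Suc k)
  define g where "g = (finite_symmetric_kernel.op (words N) kernel ^^ k) root"
  have g: "g w' = (walk ^^ k) root w'" if "w' \<in> words N" for w'
    unfolding g_def using Suc.IH[OF _ that] Suc.prems by simp
  have mem: "tl w \<in> words N" using Suc.prems by (simp add: words_def)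
  have child: "(if length w < N then up (x # w) * g (x # w) else 0) = up (x # w) * (walk ^^ k) root (x # w)" for x
  proof (cases "length w < N")
    case True
    then show ?thesis using g[of "x # w"] by (simp add: words_def)
  next
    case False
    then have "(walk ^^ k) root (x # w) = 0" using Suc.prems by (intro walk_support) simp
    then show ?thesis using False by simp
  qed
  have "(finite_symmetric_kernel.op (words N) kernel ^^ Suc k) root w = (\<Sum>w'\<in>words N. kernel w w' * g w')"
    by (simp add: g_def finite_symmetric_kernel.op_def[OF finite_kernel])
  also have "\<dots> = walk ((walk ^^ k) root) w"
    unfolding kernel_sum[OF Suc.prems(2)] child walk_eq[of "(walk ^^ k) root"] using g[OF Suc.prems(2)] g[OF mem] by simp
  finally show ?case by simp
qed simp

text \<open>The truncation at depth \<open>N\<close> has the right moments up to order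
  \<open>N\<close>, so a limit in \<open>N\<close> has all of them. The radius is that of
  \<open>spectral_measure\<close> for the row bound \<open>5 * R\<close>.\<close>

lemma moment_measure:
  obtains m where "supported_within (15 * R) m" "\<And>k. moment m k = G $ k"
proof -
  have "\<forall>N. \<exists>m. supported_within (15 * R) m \<and> (\<forall>k\<le>N. moment m k = G $ k)"
  proof
    fix N
    interpret K: finite_symmetric_kernel "words N" kernel "[]" "5 * R" by (rule finite_kernel)
    have root: "K.unit_vec = root" by (rule ext) (simp add: K.unit_vec_def root_def)
    obtain m where m: "supported_within (3 * (5 * R)) m" "\<And>k. moment m k = (K.op ^^ k) K.unit_vec []"
      by (rule K.spectral_measure) (rule that)
    have "moment m k = G $ k" if "k \<le> N" for k
      unfolding m(2) root G_nth by (rule truncated_walk[OF that]) (simp add: words_def)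
    with m(1) show "\<exists>m. supported_within (15 * R) m \<and> (\<forall>k\<le>N. moment m k = G $ k)" by auto
  qed
  from choice[OF this] obtain M where M: "\<And>N. supported_within (15 * R) (M N)"
    "\<And>N k. k \<le> N \<Longrightarrow> moment (M N) k = G $ k" by auto
  have lim: "(\<lambda>N. moment (M N) k) \<longlonglongrightarrow> G $ k" for k
    by (rule tendsto_eventually, rule eventually_mono[OF eventually_ge_at_top[of k]], rule M(2))
  show ?thesis
    by (rule moment_limit[where M=M and R="15 * R" and c="\<lambda>k. G $ k", OF M(1) _ lim])
       (use R_pos in simp, rule that)
qed

end

section \<open>Intertwining the two convolutions\<close>

lemma free_convolution_exists:
  assumes "cs_prob m1" "cs_prob m2"
  shows "\<exists>m. cs_prob m \<and> R_transform m = R_transform m1 + R_transform m2"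
proof -
  define \<mu> where "\<mu> i = (if i then m1 else m2)" for i
  have cs: "cs_prob (\<mu> i)" for i using assms by (simp add: \<mu>_def)
  obtain R1 where R1: "supported_within R1 (\<mu> True)" "R1 > 0" using cs_prob_supported_within[OF cs] .
  obtain R2 where R2: "supported_within R2 (\<mu> False)" "R2 > 0" using cs_prob_supported_within[OF cs] .
  define R where "R = max R1 R2"
  have R: "R > 0" using R1 by (simp add: R_def)
  have supp: "supported_within R (\<mu> i)" for i
    using R1 R2 supported_within_mono[of _ "\<mu> i" R] by (cases i) (auto simp: R_def)
  \<comment> \<open>One tuple for each \<open>i\<close>, so that a single use of
    \<open>choice\<close> selects all coefficients.\<close>
  have "\<forall>i. \<exists>c :: (nat \<Rightarrow> real) \<times> (nat \<Rightarrow> real) \<times> (nat \<Rightarrow> nat \<Rightarrow> real). case c of (a, b, q) \<Rightarrow>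
    (\<forall>n. \<bar>a n\<bar> \<le> R) \<and> (\<forall>n. \<bar>b n\<bar> \<le> R) \<and> (\<forall>n. q n 0 = (if n = 0 then 1 else 0)) \<and>
    (\<forall>n k. q n (Suc k) = a (Suc n) * q (Suc n) k + b n * q n k + (if n = 0 then 0 else a n * q (n - 1) k)) \<and>
    (\<forall>k. q 0 k = moment (\<mu> i) k)"
  proof
    fix i
    obtain a b :: "nat \<Rightarrow> real" and q :: "nat \<Rightarrow> nat \<Rightarrow> real" where
      "\<And>n. \<bar>a n\<bar> \<le> \<bar>R\<bar>" "\<And>n. \<bar>b n\<bar> \<le> \<bar>R\<bar>" "\<And>n. q n 0 = (if n = 0 then 1 else 0)"
      "\<And>n k. q n (Suc k) = a (Suc n) * q (Suc n) k + b n * q n k + (if n = 0 then 0 else a n * q (n - 1) k)"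
      "\<And>k. q 0 k = moment (\<mu> i) k"
      by (rule jacobi_coefficients[OF supp[of i]]) (rule that)
    then show "\<exists>c :: (nat \<Rightarrow> real) \<times> (nat \<Rightarrow> real) \<times> (nat \<Rightarrow> nat \<Rightarrow> real). case c of (a, b, q) \<Rightarrow>
      (\<forall>n. \<bar>a n\<bar> \<le> R) \<and> (\<forall>n. \<bar>b n\<bar> \<le> R) \<and> (\<forall>n. q n 0 = (if n = 0 then 1 else 0)) \<and>
      (\<forall>n k. q n (Suc k) = a (Suc n) * q (Suc n) k + b n * q n k + (if n = 0 then 0 else a n * q (n - 1) k)) \<and>
      (\<forall>k. q 0 k = moment (\<mu> i) k)"
      using R by (intro exI[of _ "(a, b, q)"]) simp
  qed
  from choice[OF this] obtain c where c: "\<forall>i. case c i of (a, b, q) \<Rightarrow>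
    (\<forall>n. \<bar>a n\<bar> \<le> R) \<and> (\<forall>n. \<bar>b n\<bar> \<le> R) \<and> (\<forall>n. q n 0 = (if n = 0 then 1 else 0)) \<and>
    (\<forall>n k. q n (Suc k) = a (Suc n) * q (Suc n) k + b n * q n k + (if n = 0 then 0 else a n * q (n - 1) k)) \<and>
    (\<forall>k. q 0 k = moment (\<mu> i) k)" ..
  define a b q where "a i = fst (c i)" and "b i = fst (snd (c i))" and "q i = snd (snd (c i))" for i
  have abq: "(\<forall>n. \<bar>a i n\<bar> \<le> R) \<and> (\<forall>n. \<bar>b i n\<bar> \<le> R) \<and> (\<forall>n. q i n 0 = (if n = 0 then 1 else 0)) \<and>
    (\<forall>n k. q i n (Suc k) = a i (Suc n) * q i (Suc n) k + b i n * q i n k + (if n = 0 then 0 else a i n * q i (n - 1) k)) \<and>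
    (\<forall>k. q i 0 k = moment (\<mu> i) k)" for i
    using c by (simp add: a_def b_def q_def case_prod_beta)
  have q_moment: "Abs_fps (q i 0) = Abs_fps (moment (\<mu> i))" for i
    by (rule fps_ext) (use abq in simp)
  obtain G :: "real fps" and C :: "bool \<Rightarrow> real fps" where GC: "G $ 0 = 1" "\<And>i. C i $ 0 = 1"
    "\<And>i. C i * (Abs_fps (moment (\<mu> i)) oo (fps_X * C i)) = G"
    "inverse (C True) + inverse (C False) = 1 + inverse G"
    "1 / fps_to_fls (fps_inv (fps_X * G)) - 1 / fls_X =
      (1 / fps_to_fls (fps_inv (fps_X * Abs_fps (moment (\<mu> True)))) - 1 / fls_X) +
      (1 / fps_to_fls (fps_inv (fps_X * Abs_fps (moment (\<mu> False)))) - 1 / fls_X)"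
    by (rule subordination_series[of "\<lambda>i. Abs_fps (moment (\<mu> i))"])
       (simp add: cs_prob_moment_0 cs, rule that)
  interpret tree_walk a b q R G C
    by unfold_locales (use R abq GC q_moment in auto)
  obtain m where m: "supported_within (15 * R) m" "\<And>k. moment m k = G $ k" by (rule moment_measure) (rule that)
  have "Abs_fps (moment m) = G" by (rule fps_ext) (simp add: m(2))
  then have "moment_series m = fps_X * G" by (simp only: moment_series_def)
  then have "R_transform m = R_transform (\<mu> True) + R_transform (\<mu> False)"
    using GC(5) by (simp only: R_transform_def moment_series_def)
  then have "R_transform m = R_transform m1 + R_transform m2" by (simp add: \<mu>_def)
  with supported_within_imp_cs_prob[OF m(1)] show ?thesis by blast
qed

section \<open>Uniqueness of the convolutions and the change of variable\<close>

lemma moment_series_nth_01: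
  assumes "cs_prob m"
  shows "moment_series m $ 0 = 0" "moment_series m $ 1 = 1"
  using cs_prob_moment_0[OF assms] by (simp_all add: moment_series_def)

lemma cs_prob_moment_series_eqI:
  assumes m: "cs_prob m1" "cs_prob m2" and eq: "moment_series m1 = moment_series m2"
  shows "m1 = m2"
proof (rule cs_prob_moment_eqI[OF m])
  fix k
  have "moment_series m1 $ Suc k = moment_series m2 $ Suc k" using eq by simp
  then show "moment m1 k = moment m2 k" by (simp add: moment_series_def)
qed

text \<open>Both transforms subtract a fixed series from this reciprocal, so this one statement
  gives uniqueness for both convolutions.\<close>

lemma cs_prob_eqI_fps_inv:
  assumes m: "cs_prob m1" "cs_prob m2"
    and eq: "1 / fps_to_fls (fps_inv (moment_series m1)) = 1 / fps_to_fls (fps_inv (moment_series m2))"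
  shows "m1 = m2"
proof (rule cs_prob_moment_series_eqI[OF m])
  from eq have "inverse (fps_to_fls (fps_inv (moment_series m1))) = inverse (fps_to_fls (fps_inv (moment_series m2)))"
    by (simp add: divide_inverse)
  then have "fps_inv (moment_series m1) = fps_inv (moment_series m2)"
    by (simp only: inverse_eq_iff_eq fps_to_fls_eq_iff)
  then have "fps_inv (fps_inv (moment_series m1)) = fps_inv (fps_inv (moment_series m2))" by simp
  then show "moment_series m1 = moment_series m2"
    using moment_series_nth_01[OF m(1)] moment_series_nth_01[OF m(2)] by (simp add: fps_inv_idempotent)
qed

lemma free_conv_eqI:
  assumes "cs_prob m" "R_transform m = R_transform m1 + R_transform m2"
  shows "m1 \<boxplus> m2 = m"
  unfolding free_conv_def
proof (rule the_equality)
  fix m' assume "cs_prob m' \<and> R_transform m' = R_transform m1 + R_transform m2"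
  then have "cs_prob m'" "R_transform m' = R_transform m" using assms(2) by simp_all
  with assms(1) show "m' = m"
    by (intro cs_prob_eqI_fps_inv) (simp_all only: R_transform_def diff_eq_eq diff_add_cancel)
qed (use assms in simp)

lemma quant_free_conv_eqI:
  assumes "cs_prob_density_le_1 m" "R_quant m = R_quant m1 + R_quant m2"
  shows "m1 \<otimes> m2 = m"
  unfolding quant_free_conv_def
proof (rule the_equality)
  fix m' assume "cs_prob_density_le_1 m' \<and> R_quant m' = R_quant m1 + R_quant m2"
  then have "cs_prob m'" "R_quant m' = R_quant m"
    using assms(2) by (simp_all add: cs_prob_density_le_1_def)
  moreover have "cs_prob m" using assms(1) by (simp add: cs_prob_density_le_1_def)
  ultimately show "m' = m"
    by (intro cs_prob_eqI_fps_inv) (simp_all only: R_quant_def diff_eq_eq diff_add_cancel)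
qed (use assms in simp)

definition one_minus_exp :: "real fps" where "one_minus_exp = 1 - fps_exp (- 1)"

lemma one_minus_exp_nth_0: "one_minus_exp $ 0 = 0" and one_minus_exp_neq_0: "one_minus_exp \<noteq> 0"
proof -
  show "one_minus_exp $ 0 = 0" by (simp add: one_minus_exp_def)
  have "one_minus_exp $ 1 = 1" by (simp add: one_minus_exp_def)
  then show "one_minus_exp \<noteq> 0" by force
qed

text \<open>\<open>S\<^sub>Q = one_minus_exp oo S\<^sub>\<rho>\<close>, so the compositional inverses satisfy \<open>S\<^sub>\<rho>\<^sup>-\<^sup>1 = S\<^sub>Q\<^sup>-\<^sup>1 oo one_minus_exp\<close>.\<close>
lemma R_quant_eq:
  assumes r: "cs_prob r" and m: "cs_prob m"
    and eq: "fps_exp 1 oo (- moment_series r) = 1 - moment_series m"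
  shows "R_quant r = fls_compose_fps (R_transform m) one_minus_exp"
proof -
  let ?S = "moment_series r" and ?Q = "moment_series m"
  note S = moment_series_nth_01[OF r] and Q = moment_series_nth_01[OF m]
  have const: "fps_const (-1 :: real) = -1" by (simp flip: fps_const_neg)
  have "fps_exp (-1) oo ?S = fps_exp 1 oo (- ?S)"
    by (rule fps_linear_ode_unique[where p="- fps_deriv ?S"])
       (use S in \<open>simp_all add: fps_exp_compose_deriv fps_compose_deriv fps_compose_uminus const mult.commute del: fps_const_neg\<close>)
  then have Q_eq: "one_minus_exp oo ?S = ?Q"
    using S by (simp add: one_minus_exp_def fps_compose_sub_distrib eq)
  have invQ0: "fps_inv ?Q $ 0 = 0" and invS0: "fps_inv ?S $ 0 = 0"
    using fps_inv_nth_1[OF Q] fps_inv_nth_1[OF S] by auto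
  have "fps_inv ?Q oo one_minus_exp = (fps_inv ?Q oo one_minus_exp) oo (?S oo fps_inv ?S)"
    using S by (simp add: fps_inv_right)
  also have "\<dots> = ((fps_inv ?Q oo one_minus_exp) oo ?S) oo fps_inv ?S"
    by (rule fps_compose_assoc) (use S invS0 in auto)
  also have "(fps_inv ?Q oo one_minus_exp) oo ?S = fps_inv ?Q oo (one_minus_exp oo ?S)"
    by (rule fps_compose_assoc[symmetric]) (use S one_minus_exp_nth_0 in auto)
  also have "\<dots> = fps_X" unfolding Q_eq by (rule fps_inv) (use Q in auto)
  also have "fps_X oo fps_inv ?S = fps_inv ?S" using invS0 by simp
  finally have inv: "fps_inv ?S = fps_inv ?Q oo one_minus_exp" ..
  \<comment> \<open>Composition with \<open>one_minus_exp\<close> turns the subtracted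
    \<open>1 / fls_X\<close> of \<open>R_transform\<close> into the subtracted term of
    \<open>R_quant\<close>; this is where the quantized form comes from.\<close>
  show ?thesis
    by (simp only: R_quant_def R_transform_def inv one_minus_exp_def[symmetric] fls_compose_fps_X fls_compose_fps_1
      fls_compose_fps_diff[OF one_minus_exp_neq_0 one_minus_exp_nth_0] fls_compose_fps_divide[OF one_minus_exp_neq_0 one_minus_exp_nth_0]
      fls_compose_fps_to_fls[OF one_minus_exp_neq_0 one_minus_exp_nth_0])
qed

theorem theorem1p9:
  "\<exists>Q :: real measure \<Rightarrow> real measure.
     (\<forall>\<rho>. cs_prob_density_le_1 \<rho> \<longrightarrow>
        cs_prob (Q \<rho>) \<and>
        fps_exp 1 oo (- moment_series \<rho>) = 1 - moment_series (Q \<rho>)) \<and>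
     (\<forall>\<rho>1 \<rho>2. cs_prob_density_le_1 \<rho>1 \<longrightarrow> cs_prob_density_le_1 \<rho>2 \<longrightarrow>
        Q \<rho>1 \<boxplus> Q \<rho>2 = Q (\<rho>1 \<otimes> \<rho>2))"
proof -
  \<comment> \<open>The choice is forced on admissible \<open>r\<close>, since the series identity
    prescribes every moment.\<close>
  define Q where "Q r = (SOME m. cs_prob m \<and> fps_exp 1 oo (- moment_series r) = 1 - moment_series m)" for r
  have Q: "cs_prob (Q r)" "fps_exp 1 oo (- moment_series r) = 1 - moment_series (Q r)"
    if "cs_prob_density_le_1 r" for r
    using someI_ex[OF exp_moment_series_exists[OF that]] by (simp_all add: Q_def)
  have cs: "cs_prob r" if "cs_prob_density_le_1 r" for r using that by (simp add: cs_prob_density_le_1_def)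
  have "Q r1 \<boxplus> Q r2 = Q (r1 \<otimes> r2)" if r1: "cs_prob_density_le_1 r1" and r2: "cs_prob_density_le_1 r2" for r1 r2
  proof -
    obtain m where m: "cs_prob m" "R_transform m = R_transform (Q r1) + R_transform (Q r2)"
      using free_convolution_exists[OF Q(1)[OF r1] Q(1)[OF r2]] by blast
    obtain r where r: "cs_prob_density_le_1 r" "fps_exp 1 oo (- moment_series r) = 1 - moment_series m"
      using exp_moment_series_surj[OF m(1)] by blast
    have "R_quant r = fls_compose_fps (R_transform m) one_minus_exp" by (rule R_quant_eq[OF cs[OF r(1)] m(1) r(2)])
    also have "\<dots> = R_quant r1 + R_quant r2"
      by (simp add: m(2) fls_compose_fps_add one_minus_exp_nth_0 one_minus_exp_neq_0
        R_quant_eq[OF cs[OF r1] Q[OF r1]] R_quant_eq[OF cs[OF r2] Q[OF r2]])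
    finally have "r1 \<otimes> r2 = r" by (rule quant_free_conv_eqI[OF r(1)])
    moreover have "Q r = m"
      by (rule cs_prob_moment_series_eqI[OF Q(1)[OF r(1)] m(1)]) (use Q(2)[OF r(1)] r(2) in simp)
    ultimately show ?thesis using free_conv_eqI[OF m] by simp
  qed
  with Q show ?thesis by (intro exI[of _ Q]) simp
qed

end
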